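(* Let $f\colon[0,1]\to[0,1]$ be a two-branched interval map for which there exists $r_1\in(0,1)$ such that conditions (1)--(5) of the context hold. Then the set $$\mathcal{E}_f:=\{x\in[0,1]\colon [0,\epsilon)\cap\{f^n x\}_{n\ge 0}=\emptyset \text{ for some } \epsilon>0\}$$ is strong winning for Schmidt's game on $[0,1]$.
   Context: Conditions on $f$ and $r_1$ (one-sided derivatives are used where needed; at $r_1$ the one-sided derivatives are understood as the one-sided limits of $f'$): (1) $f((0,r_1))=f((r_1,1))=(0,1)$; (2) $f$ is $C^1$ on $[0,r_1)$ and $C^2$ on $(0,r_1)\cup(r_1,1]$; (3) $f(0)=f(r_1)=0$, $f'(0)=1$, and $|f'|>1$ on $(0,1]$ (including both one-sided derivatives at $r_1$; hence $\inf_{x\in[\epsilon,1]}|f'(x)|>1$ for every $\epsilon>0$); (4) $\sup_{x\in[0,1]}|f'(x)|<\infty$ and $\sup_{x\in(r_1,1]}|f''(x)|<\infty$; (5) there exist $C\ge1$ and $\gamma>0$ such that $C^{-1}\le f''(x)/x^{\gamma-1}\le C$ for all $x\in(0,r_1)$. On $(r_1,1]$ the map $f$ may be either increasing or decreasing. Strong winning. Let $X$ be a compact nondegenerate interval, $S\subset X$, and $\alpha,\beta\in(0,1)$. In the strong $(\alpha,\beta)$-game, two players Bob and Alice alternately choose nested nondegenerate closed intervals $X\supset B_1\supset A_1\supset B_2\supset A_2\supset\cdots$, Bob choosing $B_1$ (of arbitrary length), then Alice $A_1$, and so on, subject to $|A_n|\ge\alpha|B_n|$ and $|B_{n+1}|\ge\beta|A_n|$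 for all $n\ge 1$ ($|\cdot|$ denotes length). Alice wins if and only if $\bigcap_n B_n$ meets $S$ (when $\bigcap_n B_n=\{\omega\}$ this means $\omega\in S$). $S$ is $(\alpha,\beta)$-strong winning if Alice has a strategy that wins regardless of Bob's choices; $\alpha$-strong winning if it is $(\alpha,\beta)$-strong winning for every $\beta\in(0,1)$; strong winning if it is $\alpha$-strong winning for some $\alpha\in(0,1)$. *)

theory Defs
  imports Complex_Main
begin

text \<open>
  Derivatives are taken within \<open>S\<close>, hence are one-sided at endpoints of \<open>S\<close> that belong to \<open>S\<close>.
\<close>

definition C1_with_deriv :: "real set \<Rightarrow> (real \<Rightarrow> real) \<Rightarrow> (real \<Rightarrow> real) \<Rightarrow> bool" where
  "C1_with_deriv S g g' \<longleftrightarrow>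
     (\<forall>x\<in>S. (g has_real_derivative g' x) (at x within S)) \<and> continuous_on S g'"

text \<open>
  Only the values of \<open>f\<close> on \<open>[0,1]\<close> matter. The functions \<open>f'\<close> and \<open>f''\<close> are determined by \<open>f\<close>
  on \<open>[0,1] - {r\<^sub>1}\<close> and on \<open>(0,r\<^sub>1) \<union> (r\<^sub>1,1]\<close> respectively; their values elsewhere are never used.
  In particular the one-sided derivatives at \<open>r\<^sub>1\<close> are the one-sided limits of \<open>f'\<close>; as these are
  required to exist as real numbers, omitting \<open>r\<^sub>1\<close> from the first supremum condition loses nothing.
\<close>

definition two_branched :: "(real \<Rightarrow> real) \<Rightarrow> real \<Rightarrow> bool" where
  "two_branched f r\<^sub>1 \<longleftrightarrow> (\<exists>f' f''.
     f ` {0<..<r\<^sub>1} = {0<..<1} \<and> f ` {r\<^sub>1<..<1} = {0<..<1} \<and>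
     C1_with_deriv {0..<r\<^sub>1} f f' \<and>
     C1_with_deriv ({0<..<r\<^sub>1} \<union> {r\<^sub>1<..1}) f f' \<and>
     C1_with_deriv ({0<..<r\<^sub>1} \<union> {r\<^sub>1<..1}) f' f'' \<and>
     f 0 = 0 \<and> f r\<^sub>1 = 0 \<and> f' 0 = 1 \<and>
     (\<forall>x\<in>{0<..1} - {r\<^sub>1}. \<bar>f' x\<bar> > 1) \<and>
     (\<exists>l. (f' \<longlongrightarrow> l) (at_left r\<^sub>1) \<and> \<bar>l\<bar> > 1) \<and>
     (\<exists>l. (f' \<longlongrightarrow> l) (at_right r\<^sub>1) \<and> \<bar>l\<bar> > 1) \<and>
     bdd_above ((\<lambda>x. \<bar>f' x\<bar>) ` ({0..1} - {r\<^sub>1})) \<and>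
     bdd_above ((\<lambda>x. \<bar>f'' x\<bar>) ` {r\<^sub>1<..1}) \<and>
     (\<exists>C \<gamma>. C \<ge> 1 \<and> \<gamma> > 0 \<and>
        (\<forall>x\<in>{0<..<r\<^sub>1}. inverse C \<le> f'' x / x powr (\<gamma> - 1) \<and> f'' x / x powr (\<gamma> - 1) \<le> C)))"

definition orbit_avoids_0 :: "(real \<Rightarrow> real) \<Rightarrow> real set" where
  "orbit_avoids_0 f =
     {x \<in> {0..1}. \<exists>\<epsilon>>0. {0..<\<epsilon>} \<inter> range (\<lambda>n. (f ^^ n) x) = {}}"

text \<open>Moves of the game: the pair \<open>(a,b)\<close> with \<open>a < b\<close> stands for the interval \<open>[a,b]\<close>.\<close>

type_synonym ivl = "real \<times> real"

definition nondegenerate :: "ivl \<Rightarrow> bool" where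
  "nondegenerate I \<longleftrightarrow> fst I < snd I"

definition points :: "ivl \<Rightarrow> real set" where
  "points I = {fst I..snd I}"

definition len :: "ivl \<Rightarrow> real" where
  "len I = snd I - fst I"

text \<open>
  The moves \<open>B\<^sub>1, A\<^sub>1, B\<^sub>2, A\<^sub>2, \<dots>\<close> are indexed from \<open>0\<close>: \<open>B 0, A 0, B 1, A 1, \<dots>\<close>
\<close>

definition bob_legal :: "ivl \<Rightarrow> real \<Rightarrow> (nat \<Rightarrow> ivl) \<Rightarrow> (nat \<Rightarrow> ivl) \<Rightarrow> nat \<Rightarrow> bool" where
  "bob_legal X \<beta> B A n \<longleftrightarrow> nondegenerate (B n) \<and>
     (case n of
        0 \<Rightarrow> points (B 0) \<subseteq> points X
      | Suc m \<Rightarrow> points (B n) \<subseteq> points (A m) \<and> len (B n) \<ge> \<beta> * len (A m))"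

definition alice_legal :: "real \<Rightarrow> (nat \<Rightarrow> ivl) \<Rightarrow> (nat \<Rightarrow> ivl) \<Rightarrow> nat \<Rightarrow> bool" where
  "alice_legal \<alpha> B A n \<longleftrightarrow> nondegenerate (A n) \<and>
     points (A n) \<subseteq> points (B n) \<and> len (A n) \<ge> \<alpha> * len (B n)"

text \<open>
  A strategy for Alice maps the list of Bob's moves so far to her reply; her own earlier moves are
  determined by that list.
\<close>

definition replies :: "(ivl list \<Rightarrow> ivl) \<Rightarrow> (nat \<Rightarrow> ivl) \<Rightarrow> nat \<Rightarrow> ivl" where
  "replies \<sigma> B n = \<sigma> (map B [0..<Suc n])"

text \<open>
  Alice has to reply legally as long as Bob has moved legally so far. Demanding this position by
  position, and not only along infinite plays, excludes strategies that make Bob's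
  continuation impossible by an illegal reply.
\<close>

definition winning_strategy ::
  "ivl \<Rightarrow> real \<Rightarrow> real \<Rightarrow> real set \<Rightarrow> (ivl list \<Rightarrow> ivl) \<Rightarrow> bool" where
  "winning_strategy X \<alpha> \<beta> S \<sigma> \<longleftrightarrow> (\<forall>B.
     (\<forall>n. (\<forall>k\<le>n. bob_legal X \<beta> B (replies \<sigma> B) k) \<longrightarrow> alice_legal \<alpha> B (replies \<sigma> B) n) \<and>
     ((\<forall>n. bob_legal X \<beta> B (replies \<sigma> B) n) \<longrightarrow> (\<Inter>n. points (B n)) \<inter> S \<noteq> {}))"

definition alpha_beta_strong_winning :: "ivl \<Rightarrow> real \<Rightarrow> real \<Rightarrow> real set \<Rightarrow> bool" where
  "alpha_beta_strong_winning X \<alpha> \<beta> S \<longleftrightarrow> (\<exists>\<sigma>. winning_strategy X \<alpha> \<beta> S \<sigma>)"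

definition alpha_strong_winning :: "ivl \<Rightarrow> real \<Rightarrow> real set \<Rightarrow> bool" where
  "alpha_strong_winning X \<alpha> S \<longleftrightarrow> (\<forall>\<beta>\<in>{0<..<1}. alpha_beta_strong_winning X \<alpha> \<beta> S)"

definition strong_winning :: "ivl \<Rightarrow> real set \<Rightarrow> bool" where
  "strong_winning X S \<longleftrightarrow> (\<exists>\<alpha>\<in>{0<..<1}. alpha_strong_winning X \<alpha> S)"

end

(*
  Let g0 and g1 be the inverse branches of f. The branches phi k = g0^k o g1 of the first passage
  map through the right interval form an infinite iterated function system, and for a word w write
  G w for the corresponding composition. A point has its orbit bounded away from 0 as soon as its
  distance to every G w 0 is at least a fixed multiple of the length |I_w| of the cylinder
  I_w = G w [0,1]. This uses bounded distortion of all G w, which follows once ln |(phi k)'| is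
  Lipschitz uniformly in k: along the neutral branch the contributions telescope because f' is
  monotone there, and condition (5) makes f'' comparable to a constant on each interval
  [g0^(j+1) x, g0^j x].

  In the game, Alice chooses between two fixed disjoint fifths of Bob's interval B, away from its
  endpoints, so as to halve the potential: the sum of (|I_w| / |B|)^s over the words w with
  |I_w| >= |B| and G w 0 in B. For small s one round multiplies each summand by at most 3/2, and the
  number of new summands is bounded, so the potential stays bounded. Hence G w 0 has left Bob's
  interval by the time |B| is a fixed fraction of |I_w|.
*)

theory Submission
  imports Defs "HOL-Library.Sublist" "HOL-Analysis.Lipschitz"
begin

section \<open>A potential strategy\<close>

definition fifth :: "bool \<Rightarrow> ivl \<Rightarrow> ivl" where
  "fifth b I = (if b then (fst I + len I / 5, fst I + 2 * len I / 5)
                else (fst I + 3 * len I / 5, fst I + 4 * len I / 5))"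

lemma fifth:
  assumes "nondegenerate I"
  shows "nondegenerate (fifth b I)" "len (fifth b I) = len I / 5" "points (fifth b I) \<subseteq> points I"
    "points (fifth True I) \<inter> points (fifth False I) = {}"
  using assms by (auto simp: fifth_def nondegenerate_def len_def points_def field_simps)

lemma fifth_inner:
  assumes "nondegenerate I" "x \<in> points (fifth b I)" "z \<notin> points I"
  shows "len I / 5 \<le> \<bar>x - z\<bar>"
  using assms by (auto simp: fifth_def nondegenerate_def len_def points_def field_simps abs_if split: if_splits)

lemma points_mono_len: "nondegenerate I \<Longrightarrow> points I \<subseteq> points J \<Longrightarrow> len I \<le> len J"
  by (auto simp: points_def nondegenerate_def len_def)

definition pot :: "('i \<Rightarrow> real) \<Rightarrow> ('i \<Rightarrow> real) \<Rightarrow> real \<Rightarrow> ivl \<Rightarrow> ivl \<Rightarrow> real" where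
  "pot z l s B A = (\<Sum>i | len B \<le> l i \<and> z i \<in> points A. (l i / len B) powr s)"

definition halving_reply :: "('i \<Rightarrow> real) \<Rightarrow> ('i \<Rightarrow> real) \<Rightarrow> real \<Rightarrow> ivl \<Rightarrow> ivl" where
  "halving_reply z l s B = fifth (pot z l s B (fifth True B) \<le> pot z l s B B / 2) B"

lemma bdd_of_affine_contraction:
  fixes u :: "nat \<Rightarrow> real"
  assumes "\<And>n. u (Suc n) \<le> 3 / 4 * u n + c"
  shows "u n \<le> max (u 0) (4 * c)"
proof (induction n)
  case (Suc n)
  then show ?case using assms[of n] by (simp add: max_def split: if_splits)
qed simp

lemma strong_winning_avoiding:
  fixes z l :: "'i \<Rightarrow> real"
  assumes pos: "\<And>i. 0 < l i" and le1: "\<And>i. l i \<le> 1"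
    and sparse: "\<And>\<kappa>. \<kappa> \<ge> 1 \<Longrightarrow> \<exists>N::nat. \<forall>a. \<forall>\<rho>>0.
      finite {i. \<rho> \<le> l i \<and> l i \<le> \<kappa> * \<rho> \<and> z i \<in> {a..a+\<rho>}} \<and>
      card {i. \<rho> \<le> l i \<and> l i \<le> \<kappa> * \<rho> \<and> z i \<in> {a..a+\<rho>}} \<le> N"
    and S: "\<And>x \<epsilon>. x \<in> points X \<Longrightarrow> \<epsilon> > 0 \<Longrightarrow> (\<And>i. \<epsilon> * l i \<le> \<bar>x - z i\<bar>) \<Longrightarrow> x \<in> S"
  shows "strong_winning X S"
proof -
  have fin: "finite {i. len B \<le> l i \<and> z i \<in> points B}" if "nondegenerate B" for B
  proof -
    have p: "len B > 0" using that by (simp add: nondegenerate_def len_def)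
    define \<kappa> where "\<kappa> = max 1 (1 / len B)"
    have "\<kappa> * len B \<ge> 1" using p by (simp add: \<kappa>_def max_def field_simps)
    then have "l i \<le> \<kappa> * len B" for i using le1[of i] by linarith
    moreover have "points B = {fst B..fst B + len B}" by (simp add: points_def len_def)
    ultimately have eq: "{i. len B \<le> l i \<and> z i \<in> points B} =
      {i. len B \<le> l i \<and> l i \<le> \<kappa> * len B \<and> z i \<in> {fst B..fst B + len B}}" by auto
    show ?thesis unfolding eq using sparse[of \<kappa>] p by (metis \<kappa>_def max.cobounded1)
  qed
  have fin': "finite {i. len B \<le> l i \<and> z i \<in> points A}"
    if "nondegenerate B" "points A \<subseteq> points B" for A B
    by (rule finite_subset[OF _ fin[OF that(1)]]) (use that in auto)
  have halve: "pot z l s B (halving_reply z l s B) \<le> pot z l s B B / 2"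
    if B: "nondegenerate B" for s B
  proof (cases "pot z l s B (fifth True B) \<le> pot z l s B B / 2")
    case False
    have "pot z l s B (fifth True B) + pot z l s B (fifth False B) =
      (\<Sum>i\<in>{i. len B \<le> l i \<and> z i \<in> points (fifth True B)} \<union>
           {i. len B \<le> l i \<and> z i \<in> points (fifth False B)}. (l i / len B) powr s)"
      unfolding pot_def using fifth[OF B]
      by (subst sum.union_disjoint) (auto intro!: fin'[OF B])
    also have "\<dots> \<le> pot z l s B B"
      unfolding pot_def using fifth(3)[OF B]
      by (intro sum_mono2 fin[OF B]) auto
    finally show ?thesis using False by (auto simp: halving_reply_def)
  qed (simp add: halving_reply_def)
  have "alpha_beta_strong_winning X (1/5) \<beta> S" if \<beta>: "\<beta> \<in> {0<..<1}" for \<beta> :: real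
  proof -
    define \<tau> where "\<tau> = 5 / \<beta>"
    have \<tau>: "\<tau> > 5" using \<beta> by (simp add: \<tau>_def field_simps)
    define s where "s = ln (3/2) / ln \<tau>"
    have s: "s > 0" using \<tau> by (simp add: s_def)
    have \<tau>s: "\<tau> powr s = 3/2" using \<tau> by (simp add: s_def powr_def)
    obtain N :: nat where N: "\<And>a \<rho>. \<rho> > 0 \<Longrightarrow>
      finite {i. \<rho> \<le> l i \<and> l i \<le> \<tau> * \<rho> \<and> z i \<in> {a..a+\<rho>}} \<and>
      card {i. \<rho> \<le> l i \<and> l i \<le> \<tau> * \<rho> \<and> z i \<in> {a..a+\<rho>}} \<le> N"
      using sparse[of \<tau>] \<tau> by (auto simp del: atLeastAtMost_iff)
    have step: "pot z l s B' B' \<le> 3/4 * pot z l s B B + 3/2 * N"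
      if B: "nondegenerate B" and B': "nondegenerate B'"
        and sub: "points B' \<subseteq> points (halving_reply z l s B)" and ln': "len B \<le> \<tau> * len B'" for B B'
    proof -
      let ?A = "halving_reply z l s B"
      have p: "len B > 0" "len B' > 0" using B B' by (simp_all add: nondegenerate_def len_def)
      have AB: "points ?A \<subseteq> points B" using fifth(3)[OF B] by (simp add: halving_reply_def)
      define P where "P = {i. len B \<le> l i \<and> z i \<in> points B' \<and> len B' \<le> l i}"
      define R where "R = {i. len B' \<le> l i \<and> l i < len B \<and> z i \<in> points B'}"
      have PR: "{i. len B' \<le> l i \<and> z i \<in> points B'} = P \<union> R" "P \<inter> R = {}"
        by (auto simp: P_def R_def)
      have finP: "finite P" by (rule finite_subset[OF _ fin'[OF B AB]]) (use sub in \<open>auto simp: P_def\<close>)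
      have "R \<subseteq> {i. len B' \<le> l i \<and> l i \<le> \<tau> * len B' \<and> z i \<in> {fst B'..fst B' + len B'}}"
        using ln' by (auto simp: R_def points_def len_def)
      then have finR: "finite R" and cardR: "card R \<le> N"
        using N[OF p(2), of "fst B'"] by (meson finite_subset, meson card_mono le_trans)
      have "(l i / len B') powr s \<le> 3/2 * (l i / len B) powr s" for i
      proof -
        have "l i / len B' \<le> \<tau> * (l i / len B)"
        proof -
          have "l i * len B \<le> l i * (\<tau> * len B')" using ln' pos[of i] by (intro mult_left_mono) auto
          then show ?thesis using p by (simp add: field_simps)
        qed
        then have "(l i / len B') powr s \<le> (\<tau> * (l i / len B)) powr s"
          using pos[of i] p s by (intro powr_mono2) auto
        also have "\<dots> = 3/2 * (l i / len B) powr s"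
          by (subst powr_mult) (use \<tau> pos[of i] p \<tau>s in auto)
        finally show ?thesis .
      qed
      then have "(\<Sum>i\<in>P. (l i / len B') powr s) \<le> 3/2 * (\<Sum>i\<in>P. (l i / len B) powr s)"
        by (simp add: sum_distrib_left sum_mono)
      also have "(\<Sum>i\<in>P. (l i / len B) powr s) \<le> pot z l s B ?A"
        unfolding pot_def by (intro sum_mono2 fin'[OF B AB]) (use sub in \<open>auto simp: P_def\<close>)
      also have "\<dots> \<le> pot z l s B B / 2" by (rule halve[OF B])
      finally have 1: "(\<Sum>i\<in>P. (l i / len B') powr s) \<le> 3/4 * pot z l s B B" by simp
      have "(l i / len B') powr s \<le> 3/2" if "i \<in> R" for i
      proof -
        have "l i / len B' \<le> \<tau>" using that ln' p by (auto simp: R_def field_simps)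
        then have "(l i / len B') powr s \<le> \<tau> powr s" using pos[of i] p s by (intro powr_mono2) auto
        then show ?thesis using \<tau>s by simp
      qed
      then have "(\<Sum>i\<in>R. (l i / len B') powr s) \<le> card R * (3/2)"
        using sum_bounded_above[of R "\<lambda>i. (l i / len B') powr s" "3/2"] by simp
      also have "\<dots> \<le> 3/2 * N" using cardR by simp
      finally show ?thesis using 1 unfolding pot_def PR(1)
        by (subst sum.union_disjoint[OF finP finR PR(2)]) (simp add: pot_def)
    qed
    define \<sigma> where "\<sigma> bs = halving_reply z l s (last bs)" for bs
    have rep: "replies \<sigma> B n = halving_reply z l s (B n)" for B n
      by (simp add: replies_def \<sigma>_def)
    have "alice_legal (1/5) B (replies \<sigma> B) n" if "bob_legal X \<beta> B (replies \<sigma> B) n" for B n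
      using that fifth[of "B n"] by (simp add: alice_legal_def bob_legal_def rep halving_reply_def)
    moreover have "(\<Inter>n. points (B n)) \<inter> S \<noteq> {}"
      if legal: "\<And>n. bob_legal X \<beta> B (replies \<sigma> B) n" for B
    proof -
      define A where "A n = halving_reply z l s (B n)" for n
      have nd: "nondegenerate (B n)" for n using legal[of n] by (simp add: bob_legal_def)
      then have p: "len (B n) > 0" for n by (simp add: nondegenerate_def len_def)
      have lenA: "len (A n) = len (B n) / 5" for n
        using fifth(2)[OF nd] by (simp add: A_def halving_reply_def)
      have AB: "points (A n) \<subseteq> points (B n)" for n
        using fifth(3)[OF nd] by (simp add: A_def halving_reply_def)
      have BA: "points (B (Suc n)) \<subseteq> points (A n)" and "len (B (Suc n)) \<ge> \<beta> * len (A n)" for n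
        using legal[of "Suc n"] by (simp_all add: bob_legal_def rep A_def)
      then have "\<beta> * len (B n) \<le> 5 * len (B (Suc n))" for n
        using lenA by (metis (no_types, lifting) divide_le_eq_numeral1(1) mult.commute times_divide_eq_right)
      then have \<tau>B: "len (B n) \<le> \<tau> * len (B (Suc n))" for n
        using \<beta> by (simp add: \<tau>_def field_simps)
      define \<Phi> where "\<Phi> = max (pot z l s (B 0) (B 0)) (4 * (3/2 * N))"
      have \<Phi>: "pot z l s (B n) (B n) \<le> \<Phi>" for n
        unfolding \<Phi>_def
        by (rule bdd_of_affine_contraction[of "\<lambda>n. pot z l s (B n) (B n)"])
           (use step[OF nd nd] BA \<tau>B in \<open>auto simp: A_def\<close>)
      define Q where "Q = max 1 (\<Phi> powr (1/s))"
      have Q1: "Q \<ge> 1" by (simp add: Q_def)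
      have Q: "l i \<le> Q * len (B n)" if zi: "z i \<in> points (B n)" for i n
      proof (cases "len (B n) \<le> l i")
        case True
        have "(l i / len (B n)) powr s \<le> pot z l s (B n) (B n)"
          unfolding pot_def by (rule member_le_sum) (use True zi fin[OF nd] in auto)
        with \<Phi>[of n] have "(l i / len (B n)) powr s \<le> \<Phi>" by linarith
        then have "((l i / len (B n)) powr s) powr (1/s) \<le> \<Phi> powr (1/s)"
          using s by (intro powr_mono2) auto
        then have "l i / len (B n) \<le> \<Phi> powr (1/s)"
          using s pos[of i] p[of n] by (simp add: powr_powr)
        then have "l i / len (B n) \<le> Q" by (simp add: Q_def)
        then show ?thesis using p[of n] by (simp add: field_simps)
      next
        case False
        moreover have "1 * len (B n) \<le> Q * len (B n)" using Q1 p[of n] by (intro mult_right_mono) auto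
        ultimately show ?thesis by simp
      qed
      have fifth_step: "len (B (Suc n)) \<le> len (B n) / 5" for n
        using points_mono_len[OF nd BA] lenA by simp
      have geom: "len (B n) \<le> len (B 0) * (1/5) ^ n" for n
      proof (induction n)
        case (Suc n)
        then show ?case using fifth_step[of n] by simp
      qed simp
      have anti: "points (B n) \<subseteq> points (B m)" if "m \<le> n" for m n
        using lift_Suc_antimono_le[of "\<lambda>n. points (B n)", OF _ that] AB BA by blast
      have cross: "fst (B n) \<le> snd (B m)" for m n
      proof (cases "m \<le> n")
        case True
        then show ?thesis using anti[OF True] nd[of n]
          by (auto simp: points_def nondegenerate_def subset_eq)
      next
        case False
        then show ?thesis using anti[of n m] nd[of m]
          by (auto simp: points_def nondegenerate_def subset_eq)
      qed
      define x where "x = (SUP n. fst (B n))"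
      have "bdd_above (range (\<lambda>n. fst (B n)))" using cross[of _ 0] by (intro bdd_aboveI2)
      then have x: "x \<in> points (B n)" for n
        using cross[of _ n] by (auto simp: points_def x_def intro: cSUP_upper cSUP_least)
      have shrink: "\<exists>n. Q * len (B n) < l i" for i
      proof -
        have "(\<lambda>n. Q * (len (B 0) * (1/5) ^ n)) \<longlonglongrightarrow> Q * (len (B 0) * 0)"
          by (intro tendsto_intros LIMSEQ_power_zero) auto
        then have "\<forall>\<^sub>F n in sequentially. Q * (len (B 0) * (1/5) ^ n) < l i"
          using pos[of i] by (intro order_tendstoD) auto
        then obtain n where "Q * (len (B 0) * (1/5) ^ n) < l i"
          by (auto simp: eventually_sequentially)
        moreover have "Q * len (B n) \<le> Q * (len (B 0) * (1/5) ^ n)"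
          using Q1 geom[of n] by (intro mult_left_mono) auto
        ultimately show ?thesis by (intro exI[of _ n]) simp
      qed
      define \<epsilon> where "\<epsilon> = min (len (B 0) / 5) (1 / (5 * \<tau> * Q))"
      have "\<epsilon> * l i \<le> \<bar>x - z i\<bar>" for i
      proof -
        define n where "n = (LEAST n. Q * len (B n) < l i)"
        have n: "Q * len (B n) < l i" unfolding n_def by (rule LeastI_ex[OF shrink])
        then have "z i \<notin> points (B n)" using Q[of i n] by auto
        moreover have "x \<in> points (A n)" using x BA by blast
        ultimately have far: "len (B n) / 5 \<le> \<bar>x - z i\<bar>"
          by (intro fifth_inner[OF nd]) (auto simp: A_def halving_reply_def)
        show ?thesis
        proof (cases n)
          case 0
          have "\<epsilon> * l i \<le> \<epsilon> * 1" using le1[of i] \<tau> Q1 p[of 0] by (intro mult_left_mono) (auto simp: \<epsilon>_def)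
          also have "\<dots> \<le> len (B 0) / 5" by (simp add: \<epsilon>_def)
          finally show ?thesis using far 0 by simp
        next
          case (Suc m)
          have "\<not> Q * len (B m) < l i" using not_less_Least[of m "\<lambda>n. Q * len (B n) < l i"] Suc
            by (simp add: n_def)
          then have "l i \<le> Q * len (B m)" by simp
          also have "\<dots> \<le> Q * (\<tau> * len (B n))" using \<tau>B[of m] Q1 Suc by (intro mult_left_mono) auto
          finally have "l i * (1 / (5 * \<tau> * Q)) \<le> len (B n) / 5" using Q1 \<tau> by (simp add: field_simps)
          moreover have "\<epsilon> * l i \<le> 1 / (5 * \<tau> * Q) * l i"
            using pos[of i] by (intro mult_right_mono) (auto simp: \<epsilon>_def)
          ultimately show ?thesis using far by (simp add: mult.commute)
        qed
      qed
      moreover have "\<epsilon> > 0" using p[of 0] \<tau> Q1 by (simp add: \<epsilon>_def)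
      moreover have "x \<in> points X" using x[of 0] legal[of 0] by (auto simp: bob_legal_def)
      ultimately have "x \<in> S" using S by blast
      then show ?thesis using x by blast
    qed
    ultimately have "winning_strategy X (1/5) \<beta> S \<sigma>" by (auto simp: winning_strategy_def)
    then show ?thesis by (auto simp: alpha_beta_strong_winning_def)
  qed
  then show ?thesis unfolding strong_winning_def alpha_strong_winning_def
    by (intro bexI[of _ "1/5"]) auto
qed

section \<open>Inverse branches\<close>

lemma increasing_inverse_branch:
  fixes h h' :: "real \<Rightarrow> real"
  assumes ab: "a < b" and \<mu>: "\<mu> > 0" and img: "h ` {a<..<b} = {0<..<1}"
    and der: "\<And>x. x \<in> {a<..<b} \<Longrightarrow> (h has_real_derivative h' x) (at x)"
    and ge: "\<And>x. x \<in> {a<..<b} \<Longrightarrow> \<mu> \<le> h' x"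
  obtains g where "\<And>y. y \<in> {0<..<1} \<Longrightarrow> g y \<in> {a<..<b}" "\<And>y. y \<in> {0<..<1} \<Longrightarrow> h (g y) = y"
    "g 0 = a" "g 1 = b" "\<And>x. x \<in> {a<..<b} \<Longrightarrow> g (h x) = x"
    "\<And>x y. x \<in> {0..1} \<Longrightarrow> y \<in> {0..1} \<Longrightarrow> x \<le> y \<Longrightarrow> g x \<le> g y"
    "\<And>x y. x \<in> {0..1} \<Longrightarrow> y \<in> {0..1} \<Longrightarrow> x \<le> y \<Longrightarrow> \<mu> * (g y - g x) \<le> y - x"
    "\<And>y. y \<in> {0<..<1} \<Longrightarrow> (g has_real_derivative inverse (h' (g y))) (at y)"
proof -
  have expand: "\<mu> * (q - p) \<le> h q - h p" if pq: "p \<in> {a<..<b}" "q \<in> {a<..<b}" "p \<le> q" for p q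
  proof (cases "p = q")
    case False
    then have "p < q" using pq by simp
    have "(h has_real_derivative h' x) (at x)" if "p \<le> x" "x \<le> q" for x
      using der[of x] that pq by auto
    then obtain x where x: "p < x" "x < q" "h q - h p = (q - p) * h' x"
      using MVT2[OF \<open>p < q\<close>] by blast
    have "\<mu> \<le> h' x" using x pq by (intro ge) auto
    then show ?thesis using \<open>p < q\<close> x(3) mult_right_mono[of \<mu> "h' x" "q - p"] by (simp add: mult.commute)
  qed simp
  have range: "h x \<in> {0<..<1}" if "x \<in> {a<..<b}" for x using img that by blast
  have inj: "inj_on h {a<..<b}"
  proof (rule inj_onI)
    fix p q assume pq: "p \<in> {a<..<b}" "q \<in> {a<..<b}" "h p = h q"
    have "\<mu> * (q - p) \<le> 0" if "p \<le> q" using expand[OF pq(1,2) that] pq(3) by simp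
    moreover have "\<mu> * (p - q) \<le> 0" if "q \<le> p" using expand[OF pq(2,1) that] pq(3) by simp
    ultimately show "p = q" using \<mu> by (cases "p \<le> q") (auto simp: mult_le_0_iff)
  qed
  define g where "g y = (if y \<le> 0 then a else if 1 \<le> y then b else inv_into {a<..<b} h y)" for y
  have g01: "g 0 = a" "g 1 = b" by (auto simp: g_def)
  have g: "g y \<in> {a<..<b}" "h (g y) = y" if "y \<in> {0<..<1}" for y
  proof -
    have "y \<in> h ` {a<..<b}" using that img by simp
    then have "inv_into {a<..<b} h y \<in> {a<..<b}" "h (inv_into {a<..<b} h y) = y"
      by (rule inv_into_into, rule f_inv_into_f)
    then show "g y \<in> {a<..<b}" "h (g y) = y" using that by (auto simp: g_def)
  qed
  have gh: "g (h x) = x" if "x \<in> {a<..<b}" for x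
    using that range[OF that] inj by (auto simp: g_def inv_into_f_f)
  have closed: "g y \<in> {a..b}" if "y \<in> {0..1}" for y
    using g(1)[of y] that ab g01 by (cases "y = 0 \<or> y = 1") auto
  have mono: "g x \<le> g y" if xy: "x \<in> {0..1}" "y \<in> {0..1}" "x \<le> y" for x y
  proof (cases "x = 0 \<or> y = 1 \<or> x = y")
    case True
    then show ?thesis using closed[of x] closed[of y] g01 xy by auto
  next
    case False
    then have "x \<in> {0<..<1}" "y \<in> {0<..<1}" using xy by auto
    note * = g[OF this(1)] g[OF this(2)]
    show ?thesis
    proof (rule ccontr)
      assume "\<not> ?thesis"
      then have "0 < \<mu> * (g x - g y)" "\<mu> * (g x - g y) \<le> x - y"
        using \<mu> expand[OF *(3,1)] *(2,4) by auto
      then show False using xy(3) by linarith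
    qed
  qed
  have L: "\<mu> * (g y - g x) \<le> y - x" if "x \<in> {0<..<1}" "y \<in> {0<..<1}" "x \<le> y" for x y
    using expand[of "g x" "g y"] g[of x] g[of y] that mono[of x y] by auto
  have L0: "\<mu> * (g y - g 0) \<le> y" if y: "y \<in> {0<..<1}" for y
  proof (rule ccontr)
    assume "\<not> ?thesis"
    then have *: "a < g y - y / \<mu>" using \<mu> g01 by (simp add: field_simps)
    then have "g y - y / \<mu> \<in> {a<..<b}" using g(1)[OF y] \<mu> y
      by (auto intro: le_less_trans[of _ "g y"])
    from expand[OF this g(1)[OF y]] range[OF this] show False using g(2)[OF y] \<mu> y by simp
  qed
  have L1: "\<mu> * (g 1 - g y) \<le> 1 - y" if y: "y \<in> {0<..<1}" for y
  proof (rule ccontr)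
    assume "\<not> ?thesis"
    then have *: "g y + (1 - y) / \<mu> < b" using \<mu> g01 by (simp add: field_simps)
    then have "g y + (1 - y) / \<mu> \<in> {a<..<b}" using g(1)[OF y] \<mu> y
      by (auto intro: less_le_trans[of _ "g y"])
    from expand[OF g(1)[OF y] this] range[OF this] show False using g(2)[OF y] \<mu> y by simp
  qed
  have lip: "\<mu> * (g y - g x) \<le> y - x" if xy: "x \<in> {0..1}" "y \<in> {0..1}" "x \<le> y" for x y
  proof -
    have "\<mu> * (g 1 - g 0) \<le> 1" using L0[of "1/2"] L1[of "1/2"] by (simp add: algebra_simps)
    then consider "x = y" | "x = 0" "y = 1" | "x = 0" "y \<in> {0<..<1}" | "y = 1" "x \<in> {0<..<1}"
      | "x \<in> {0<..<1}" "y \<in> {0<..<1}" using xy by force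
    then show ?thesis using L0[of y] L1[of x] L[of x y] xy \<open>\<mu> * (g 1 - g 0) \<le> 1\<close> by cases auto
  qed
  have "(g has_real_derivative inverse (h' (g y))) (at y)" if y: "y \<in> {0<..<1}" for y
  proof (rule DERIV_inverse_function[of h _ _ _ 0 1])
    show "(h has_real_derivative h' (g y)) (at (g y))" by (rule der[OF g(1)[OF y]])
    show "h' (g y) \<noteq> 0" using ge[OF g(1)[OF y]] \<mu> by auto
    have "(1 / \<mu>)-lipschitz_on {0<..<1} g"
    proof (rule lipschitz_onI)
      fix x x' :: real assume "x \<in> {0<..<1}" "x' \<in> {0<..<1}"
      then show "dist (g x) (g x') \<le> 1 / \<mu> * dist x x'"
        using L[of x x'] L[of x' x] mono[of x x'] mono[of x' x] \<mu>
        by (cases "x \<le> x'") (auto simp: dist_real_def field_simps)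
    qed (use \<mu> in auto)
    from lipschitz_on_continuous_on[OF this] show "isCont g y"
      using y by (simp add: continuous_on_eq_continuous_at)
    show "h (g y) = y" if "0 < y" "y < 1" for y using g(2)[of y] that by simp
  qed (use y in auto)
  then show thesis using that[OF g g01 gh mono lip] by blast
qed

lemma inverse_branch:
  fixes h h' :: "real \<Rightarrow> real"
  assumes ab: "a < b" and \<mu>: "\<mu> > 0" and img: "h ` {a<..<b} = {0<..<1}"
    and der: "\<And>x. x \<in> {a<..<b} \<Longrightarrow> (h has_real_derivative h' x) (at x)"
    and cont: "continuous_on {a<..<b} h'"
    and ge: "\<And>x. x \<in> {a<..<b} \<Longrightarrow> \<mu> \<le> \<bar>h' x\<bar>"
  obtains g where "\<And>y. y \<in> {0<..<1} \<Longrightarrow> g y \<in> {a<..<b}" "\<And>y. y \<in> {0<..<1} \<Longrightarrow> h (g y) = y"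
    "g 0 = a \<and> g 1 = b \<or> g 0 = b \<and> g 1 = a" "\<And>x. x \<in> {a<..<b} \<Longrightarrow> g (h x) = x"
    "\<And>x y. x \<in> {0..1} \<Longrightarrow> y \<in> {0..1} \<Longrightarrow> \<mu> * \<bar>g x - g y\<bar> \<le> \<bar>x - y\<bar>"
    "\<And>y. y \<in> {0<..<1} \<Longrightarrow> (g has_real_derivative inverse (h' (g y))) (at y)"
proof -
  have sign: "(\<forall>x\<in>{a<..<b}. h' x > 0) \<or> (\<forall>x\<in>{a<..<b}. h' x < 0)"
  proof (rule ccontr)
    assume "\<not> ?thesis"
    then obtain p q where pq: "p \<in> {a<..<b}" "h' p \<le> 0" "q \<in> {a<..<b}" "0 \<le> h' q"
      by (auto simp: not_less)
    have "connected (h' ` {a<..<b})" by (rule connected_continuous_image[OF cont]) simp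
    from connectedD_interval[OF this imageI[OF pq(1)] imageI[OF pq(3)] pq(2,4)]
    obtain x where "x \<in> {a<..<b}" "h' x = 0" by auto
    then show False using ge[of x] \<mu> by simp
  qed
  then show thesis
  proof
    assume pos: "\<forall>x\<in>{a<..<b}. h' x > 0"
    have ge': "\<mu> \<le> h' x" if "x \<in> {a<..<b}" for x using pos ge[OF that] that by force
    obtain g where g: "\<And>y. y \<in> {0<..<1} \<Longrightarrow> g y \<in> {a<..<b}" "\<And>y. y \<in> {0<..<1} \<Longrightarrow> h (g y) = y"
      "g 0 = a" "g 1 = b" "\<And>x. x \<in> {a<..<b} \<Longrightarrow> g (h x) = x"
      "\<And>x y. x \<in> {0..1} \<Longrightarrow> y \<in> {0..1} \<Longrightarrow> x \<le> y \<Longrightarrow> g x \<le> g y"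
      "\<And>x y. x \<in> {0..1} \<Longrightarrow> y \<in> {0..1} \<Longrightarrow> x \<le> y \<Longrightarrow> \<mu> * (g y - g x) \<le> y - x"
      "\<And>y. y \<in> {0<..<1} \<Longrightarrow> (g has_real_derivative inverse (h' (g y))) (at y)"
      using increasing_inverse_branch[OF ab \<mu> img der ge'] by blast
    have "\<mu> * \<bar>g x - g y\<bar> \<le> \<bar>x - y\<bar>" if "x \<in> {0..1}" "y \<in> {0..1}" for x y
      using g(6,7)[of x y] g(6,7)[of y x] that by (cases "x \<le> y") auto
    with g show thesis by (intro that[of g] disjI1 conjI)
  next
    assume neg: "\<forall>x\<in>{a<..<b}. h' x < 0"
    define k where "k x = h (a + b - x)" for x
    have refl: "a + b - x \<in> {a<..<b} \<longleftrightarrow> x \<in> {a<..<b}" for x by auto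
    have img': "k ` {a<..<b} = {0<..<1}"
    proof -
      have "k ` {a<..<b} = h ` ((\<lambda>x. a + b - x) ` {a<..<b})" by (auto simp: k_def)
      also have "(\<lambda>x. a + b - x) ` {a<..<b} = {a<..<b}"
      proof (intro equalityI subsetI)
        fix x assume "x \<in> {a<..<b}"
        then show "x \<in> (\<lambda>x. a + b - x) ` {a<..<b}" by (intro image_eqI[of _ _ "a + b - x"]) auto
      qed auto
      finally show ?thesis using img by simp
    qed
    have ge': "\<mu> \<le> - h' (a + b - x)" if "x \<in> {a<..<b}" for x
      using neg[rule_format, of "a + b - x"] ge[of "a + b - x"] that by auto
    have der': "(k has_real_derivative - h' (a + b - x)) (at x)" if "x \<in> {a<..<b}" for x
    proof -
      have "((\<lambda>x. a + b - x) has_real_derivative -1) (at x)" by (auto intro!: derivative_eq_intros)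
      from DERIV_chain2[OF der this] show ?thesis using that by (simp add: k_def[abs_def])
    qed
    obtain g where g: "\<And>y. y \<in> {0<..<1} \<Longrightarrow> g y \<in> {a<..<b}" "\<And>y. y \<in> {0<..<1} \<Longrightarrow> k (g y) = y"
      "g 0 = a" "g 1 = b" "\<And>x. x \<in> {a<..<b} \<Longrightarrow> g (k x) = x"
      "\<And>x y. x \<in> {0..1} \<Longrightarrow> y \<in> {0..1} \<Longrightarrow> x \<le> y \<Longrightarrow> g x \<le> g y"
      "\<And>x y. x \<in> {0..1} \<Longrightarrow> y \<in> {0..1} \<Longrightarrow> x \<le> y \<Longrightarrow> \<mu> * (g y - g x) \<le> y - x"
      "\<And>y. y \<in> {0<..<1} \<Longrightarrow> (g has_real_derivative inverse (- h' (a + b - g y))) (at y)"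
      using increasing_inverse_branch[OF ab \<mu> img' der' ge'] by blast
    have lip: "\<mu> * \<bar>(a + b - g x) - (a + b - g y)\<bar> \<le> \<bar>x - y\<bar>" if "x \<in> {0..1}" "y \<in> {0..1}" for x y
      using g(6,7)[of x y] g(6,7)[of y x] that by (cases "x \<le> y") auto
    have d: "((\<lambda>y. a + b - g y) has_real_derivative inverse (h' (a + b - g y))) (at y)" if "y \<in> {0<..<1}" for y
      using DERIV_diff[OF DERIV_const[of "a + b"] g(8)[OF that]] by simp
    have inv: "a + b - g (h x) = x" if "x \<in> {a<..<b}" for x
      using g(5)[of "a + b - x"] that refl[of x] by (simp add: k_def)
    show thesis
    proof (rule that[of "\<lambda>y. a + b - g y"])
      show "a + b - g y \<in> {a<..<b}" if "y \<in> {0<..<1}" for y using g(1)[OF that] by auto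
      show "h (a + b - g y) = y" if "y \<in> {0<..<1}" for y using g(2)[OF that] by (simp add: k_def)
      show "a + b - g 0 = a \<and> a + b - g 1 = b \<or> a + b - g 0 = b \<and> a + b - g 1 = a"
        using g(3,4) by simp
    qed (use lip d inv in blast)+
  qed
qed

section \<open>Iterated function systems with bounded distortion\<close>

lemma floor_divide_neq_of_disjoint:
  fixes a b c d \<rho> :: real
  assumes \<rho>: "\<rho> > 0" and "\<rho> \<le> \<bar>b - a\<bar>" "\<rho> \<le> \<bar>d - c\<bar>"
    and disj: "{min a b<..<max a b} \<inter> {min c d<..<max c d} = {}"
  shows "\<lfloor>(a + b) / 2 / \<rho>\<rfloor> \<noteq> \<lfloor>(c + d) / 2 / \<rho>\<rfloor>"
proof
  define m m' where "m = (a + b) / 2" and "m' = (c + d) / 2"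
  assume "\<lfloor>(a + b) / 2 / \<rho>\<rfloor> = \<lfloor>(c + d) / 2 / \<rho>\<rfloor>"
  then have "\<bar>m / \<rho> - m' / \<rho>\<bar> < 1" unfolding m_def m'_def by linarith
  then have "\<bar>m - m'\<bar> < \<rho>"
    using \<rho> by (simp add: abs_if field_simps split: if_splits)
  then have "(m + m') / 2 \<in> {min a b<..<max a b} \<inter> {min c d<..<max c d}"
    using assms(2,3) unfolding m_def m'_def by (auto simp: min_def max_def abs_if field_simps split: if_splits)
  with disj show False by blast
qed


lemma mvt_unit_interval:
  fixes h h' :: "real \<Rightarrow> real"
  assumes "continuous_on {0..1} h" "\<And>y. y \<in> {0<..<1} \<Longrightarrow> (h has_real_derivative h' y) (at y)"
    and "x \<in> {0..1}" "y \<in> {0..1}" "x < y"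
  obtains \<xi> where "x < \<xi>" "\<xi> < y" "h y - h x = h' \<xi> * (y - x)"
proof (rule mvt[of x y h "\<lambda>\<xi> d. h' \<xi> * d"])
  show "continuous_on {x..y} h" using assms by (auto intro: continuous_on_subset)
  show "(h has_derivative (*) (h' \<xi>)) (at \<xi>)" if "x < \<xi>" "\<xi> < y" for \<xi>
    using assms that by (auto simp: has_field_derivative_def[symmetric])
qed (use assms in auto)

locale conformal_ifs =
  fixes \<phi> \<phi>' :: "nat \<Rightarrow> real \<Rightarrow> real" and \<theta> C :: real
  assumes \<theta>: "0 < \<theta>" "\<theta> < 1" and C: "0 \<le> C"
    and maps_closed: "y \<in> {0..1} \<Longrightarrow> \<phi> k y \<in> {0..1}"
    and maps_open: "y \<in> {0<..<1} \<Longrightarrow> \<phi> k y \<in> {0<..<1}"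
    and cont: "continuous_on {0..1} (\<phi> k)"
    and deriv: "y \<in> {0<..<1} \<Longrightarrow> (\<phi> k has_real_derivative \<phi>' k y) (at y)"
    and deriv_nz: "y \<in> {0<..<1} \<Longrightarrow> \<phi>' k y \<noteq> 0"
    and contr: "y \<in> {0<..<1} \<Longrightarrow> \<bar>\<phi>' k y\<bar> \<le> \<theta>"
    and log_lip: "x \<in> {0<..<1} \<Longrightarrow> y \<in> {0<..<1} \<Longrightarrow> \<bar>ln \<bar>\<phi>' k x\<bar> - ln \<bar>\<phi>' k y\<bar>\<bar> \<le> C * \<bar>x - y\<bar>"
    and disjoint: "k \<noteq> j \<Longrightarrow> x \<in> {0<..<1} \<Longrightarrow> y \<in> {0<..<1} \<Longrightarrow> \<phi> k x \<noteq> \<phi> j y"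
begin

definition G :: "nat list \<Rightarrow> real \<Rightarrow> real" where
  "G w = foldr (\<lambda>k h. \<phi> k \<circ> h) w id"

definition diam :: "nat list \<Rightarrow> real" where
  "diam w = \<bar>G w 1 - G w 0\<bar>"

definition K :: real where
  "K = exp (C / (1 - \<theta>))"

lemma K_pos: "K > 0"
  by (simp add: K_def)

lemma G_simps [simp]: "G [] y = y" "G (k # w) y = \<phi> k (G w y)"
  by (simp_all add: G_def)

lemma G_append: "G (u @ v) y = G u (G v y)"
  by (induction u) auto

lemma G_closed: "y \<in> {0..1} \<Longrightarrow> G w y \<in> {0..1}"
  by (induction w) (use maps_closed in auto)

lemma G_open: "y \<in> {0<..<1} \<Longrightarrow> G w y \<in> {0<..<1}"
  by (induction w) (use maps_open in auto)

lemma G_cont: "continuous_on {0..1} (G w)"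
proof (induction w)
  case (Cons k w)
  have "continuous_on {0..1} (\<lambda>y. \<phi> k (G w y))"
    by (rule continuous_on_compose2[OF cont Cons.IH]) (use G_closed in blast)
  then show ?case by (simp add: fun_eq_iff)
qed (simp add: G_def id_def)

lemma \<phi>_lipschitz:
  assumes "x \<in> {0..1}" "y \<in> {0..1}"
  shows "\<bar>\<phi> k x - \<phi> k y\<bar> \<le> \<theta> * \<bar>x - y\<bar>"
proof -
  have *: "\<bar>\<phi> k x - \<phi> k y\<bar> \<le> \<theta> * \<bar>x - y\<bar>" if xy: "x \<in> {0..1}" "y \<in> {0..1}" "x < y" for x y
  proof -
    obtain \<xi> where "x < \<xi>" "\<xi> < y" and eq: "\<phi> k y - \<phi> k x = \<phi>' k \<xi> * (y - x)"
      using mvt_unit_interval[OF cont deriv xy] .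
    then have "\<bar>\<phi>' k \<xi>\<bar> \<le> \<theta>" using xy by (intro contr) auto
    then have "\<bar>\<phi>' k \<xi>\<bar> * \<bar>y - x\<bar> \<le> \<theta> * \<bar>y - x\<bar>" by (rule mult_right_mono) simp
    then show ?thesis by (simp add: abs_minus_commute[of "\<phi> k x"] abs_minus_commute[of x] eq abs_mult)
  qed
  show ?thesis
    using *[of x y] *[of y x] assms by (cases x y rule: linorder_cases) (auto simp: abs_minus_commute)
qed

lemma G_lipschitz:
  assumes "x \<in> {0..1}" "y \<in> {0..1}"
  shows "\<bar>G w x - G w y\<bar> \<le> \<theta> ^ length w * \<bar>x - y\<bar>"
proof (induction w)
  case (Cons k w)
  have "\<bar>G (k # w) x - G (k # w) y\<bar> \<le> \<theta> * \<bar>G w x - G w y\<bar>"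
    using \<phi>_lipschitz[OF G_closed G_closed, OF assms] by simp
  also have "\<dots> \<le> \<theta> * (\<theta> ^ length w * \<bar>x - y\<bar>)"
    using Cons.IH \<theta> by (intro mult_left_mono) auto
  finally show ?case by (simp add: mult.assoc)
qed simp

lemma G_deriv:
  "\<exists>d. (\<forall>y\<in>{0<..<1}. (G w has_real_derivative d y) (at y) \<and> d y \<noteq> 0) \<and>
    (\<forall>x\<in>{0<..<1}. \<forall>y\<in>{0<..<1}. \<bar>ln \<bar>d x\<bar> - ln \<bar>d y\<bar>\<bar> \<le> C / (1 - \<theta>) * \<bar>x - y\<bar>)"
proof (induction w rule: rev_induct)
  case Nil
  then show ?case using C \<theta> by (intro exI[of _ "\<lambda>_. 1"]) (simp add: G_def id_def)
next
  case (snoc k w)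
  then obtain d where d: "\<And>y. y \<in> {0<..<1} \<Longrightarrow> (G w has_real_derivative d y) (at y)"
    and nz: "\<And>y. y \<in> {0<..<1} \<Longrightarrow> d y \<noteq> 0"
    and lip: "\<And>x y. x \<in> {0<..<1} \<Longrightarrow> y \<in> {0<..<1} \<Longrightarrow> \<bar>ln \<bar>d x\<bar> - ln \<bar>d y\<bar>\<bar> \<le> C / (1 - \<theta>) * \<bar>x - y\<bar>"
    by blast
  have G: "G (w @ [k]) = (\<lambda>y. G w (\<phi> k y))" by (simp add: G_append fun_eq_iff)
  have "\<bar>ln \<bar>d (\<phi> k x) * \<phi>' k x\<bar> - ln \<bar>d (\<phi> k y) * \<phi>' k y\<bar>\<bar> \<le> C / (1 - \<theta>) * \<bar>x - y\<bar>"
    if xy: "x \<in> {0<..<1}" "y \<in> {0<..<1}" for x y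
  proof -
    have "\<bar>ln \<bar>d (\<phi> k x)\<bar> - ln \<bar>d (\<phi> k y)\<bar>\<bar> \<le> C / (1 - \<theta>) * \<bar>\<phi> k x - \<phi> k y\<bar>"
      by (rule lip[OF maps_open maps_open]) (use xy in auto)
    also have "\<dots> \<le> C / (1 - \<theta>) * (\<theta> * \<bar>x - y\<bar>)"
      using C \<theta> xy by (intro mult_left_mono \<phi>_lipschitz) auto
    finally have "\<bar>ln \<bar>d (\<phi> k x)\<bar> - ln \<bar>d (\<phi> k y)\<bar>\<bar> \<le> C / (1 - \<theta>) * (\<theta> * \<bar>x - y\<bar>)" .
    moreover have "\<bar>ln \<bar>\<phi>' k x\<bar> - ln \<bar>\<phi>' k y\<bar>\<bar> \<le> C * \<bar>x - y\<bar>" using xy by (rule log_lip)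
    moreover have "ln \<bar>d (\<phi> k t) * \<phi>' k t\<bar> = ln \<bar>d (\<phi> k t)\<bar> + ln \<bar>\<phi>' k t\<bar>" if "t \<in> {0<..<1}" for t
      using nz[OF maps_open[OF that]] deriv_nz[OF that] by (simp add: abs_mult ln_mult)
    moreover have "C / (1 - \<theta>) * (\<theta> * \<bar>x - y\<bar>) + C * \<bar>x - y\<bar> = C / (1 - \<theta>) * \<bar>x - y\<bar>"
      using \<theta> by (simp add: field_simps)
    ultimately show ?thesis using xy by (smt (verit))
  qed
  moreover have "(G (w @ [k]) has_real_derivative d (\<phi> k y) * \<phi>' k y) (at y)" if "y \<in> {0<..<1}" for y
    unfolding G using DERIV_chain2[OF d[OF maps_open[OF that]] deriv[OF that]] .
  moreover have "d (\<phi> k y) * \<phi>' k y \<noteq> 0" if "y \<in> {0<..<1}" for y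
    using nz[OF maps_open[OF that]] deriv_nz[OF that] by simp
  ultimately show ?case by (intro exI[of _ "\<lambda>y. d (\<phi> k y) * \<phi>' k y"]) blast
qed

lemma bounded_distortion:
  assumes "x \<in> {0..1}" "y \<in> {0..1}"
  shows "\<bar>G w x - G w y\<bar> \<le> K * \<bar>x - y\<bar> * diam w"
proof -
  obtain d where d: "\<And>y. y \<in> {0<..<1} \<Longrightarrow> (G w has_real_derivative d y) (at y)"
    and nz: "\<And>y. y \<in> {0<..<1} \<Longrightarrow> d y \<noteq> 0"
    and lip: "\<And>x y. x \<in> {0<..<1} \<Longrightarrow> y \<in> {0<..<1} \<Longrightarrow> \<bar>ln \<bar>d x\<bar> - ln \<bar>d y\<bar>\<bar> \<le> C / (1 - \<theta>) * \<bar>x - y\<bar>"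
    using G_deriv[of w] by blast
  obtain \<eta> where \<eta>: "0 < \<eta>" "\<eta> < 1" and "G w 1 - G w 0 = d \<eta> * (1 - 0)"
    by (rule mvt_unit_interval[OF G_cont d, of 0 1]) auto
  then have diam: "diam w = \<bar>d \<eta>\<bar>" by (simp add: diam_def)
  have *: "\<bar>G w x - G w y\<bar> \<le> K * \<bar>x - y\<bar> * diam w" if xy: "x \<in> {0..1}" "y \<in> {0..1}" "x < y" for x y
  proof -
    obtain \<xi> where \<xi>: "x < \<xi>" "\<xi> < y" and eq: "G w y - G w x = d \<xi> * (y - x)"
      using mvt_unit_interval[OF G_cont d xy] .
    have in01: "\<xi> \<in> {0<..<1}" "\<eta> \<in> {0<..<1}" using \<xi> \<eta> xy by auto
    have "ln \<bar>d \<xi>\<bar> - ln \<bar>d \<eta>\<bar> \<le> C / (1 - \<theta>) * \<bar>\<xi> - \<eta>\<bar>" using lip[OF in01] by linarith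
    also have "\<dots> \<le> C / (1 - \<theta>) * 1" using C \<theta> in01 by (intro mult_left_mono) auto
    finally have "ln \<bar>d \<xi>\<bar> \<le> C / (1 - \<theta>) + ln \<bar>d \<eta>\<bar>" by simp
    then have "exp (ln \<bar>d \<xi>\<bar>) \<le> exp (C / (1 - \<theta>) + ln \<bar>d \<eta>\<bar>)" by simp
    then have "\<bar>d \<xi>\<bar> \<le> K * diam w" using nz[OF in01(1)] nz[OF in01(2)]
      by (simp add: exp_add K_def diam)
    then have "\<bar>d \<xi>\<bar> * \<bar>y - x\<bar> \<le> K * diam w * \<bar>y - x\<bar>" by (rule mult_right_mono) simp
    then show ?thesis
      by (simp add: abs_minus_commute[of "G w x"] abs_minus_commute[of x] eq abs_mult mult_ac)
  qed
  show ?thesis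
    using *[of x y] *[of y x] assms by (cases x y rule: linorder_cases) (auto simp: abs_minus_commute)
qed

lemma G_inj:
  assumes xy: "x \<in> {0..1}" "y \<in> {0..1}" "G w x = G w y"
  shows "x = y"
proof -
  obtain d where d: "\<And>y. y \<in> {0<..<1} \<Longrightarrow> (G w has_real_derivative d y) (at y)"
    and nz: "\<And>y. y \<in> {0<..<1} \<Longrightarrow> d y \<noteq> 0"
    using G_deriv[of w] by blast
  have *: "G w x \<noteq> G w y" if xy: "x \<in> {0..1}" "y \<in> {0..1}" "x < y" for x y
  proof -
    obtain \<xi> where "x < \<xi>" "\<xi> < y" and "G w y - G w x = d \<xi> * (y - x)"
      using mvt_unit_interval[OF G_cont d xy] .
    then show ?thesis using nz[of \<xi>] xy by auto
  qed
  show ?thesis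
    using *[of x y] *[of y x] assms by (cases x y rule: linorder_cases) auto
qed

lemma diam_pos: "diam w > 0"
  using G_inj[of 1 0 w] by (auto simp: diam_def)

lemma diam_le1: "diam w \<le> 1"
  using G_closed[of 0 w] G_closed[of 1 w] by (auto simp: diam_def abs_if)

lemma diam_append: "diam (u @ v) \<le> K * \<theta> ^ length v * diam u"
proof -
  have "diam (u @ v) \<le> K * \<bar>G v 1 - G v 0\<bar> * diam u"
    unfolding diam_def[of "u @ v"] G_append by (intro bounded_distortion G_closed) auto
  also have "\<dots> \<le> K * \<theta> ^ length v * diam u"
    using G_lipschitz[of 1 0 v] K_pos diam_pos[of u] by (intro mult_left_mono mult_right_mono) auto
  finally show ?thesis .
qed

lemma open_cylinder:
  assumes "p \<in> {min (G w 0) (G w 1)<..<max (G w 0) (G w 1)}"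
  obtains y where "y \<in> {0<..<1}" "G w y = p"
proof -
  have "\<exists>y\<ge>0. y \<le> 1 \<and> G w y = p"
  proof (cases "G w 0 \<le> G w 1")
    case True
    then show ?thesis using assms G_cont by (intro IVT') auto
  next
    case False
    then show ?thesis using assms G_cont by (intro IVT2') auto
  qed
  then obtain y where "0 \<le> y" "y \<le> 1" "G w y = p" by blast
  moreover from this have "y \<noteq> 0" "y \<noteq> 1" using assms by (auto simp: min_def max_def split: if_splits)
  ultimately show ?thesis by (intro that[of y]) auto
qed

lemma parallel_disjoint:
  assumes "u \<parallel> v"
  shows "{min (G u 0) (G u 1)<..<max (G u 0) (G u 1)} \<inter> {min (G v 0) (G v 1)<..<max (G v 0) (G v 1)} = {}"
proof (rule ccontr)
  assume "\<not> ?thesis"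
  then obtain p where p: "p \<in> {min (G u 0) (G u 1)<..<max (G u 0) (G u 1)}"
    "p \<in> {min (G v 0) (G v 1)<..<max (G v 0) (G v 1)}" by blast
  obtain s where s: "s \<in> {0<..<1}" "G u s = p" using open_cylinder[OF p(1)] .
  obtain t where t: "t \<in> {0<..<1}" "G v t = p" using open_cylinder[OF p(2)] .
  obtain w k u' j v' where w: "k \<noteq> j" "u = w @ k # u'" "v = w @ j # v'"
    using parallel_decomp[OF assms] by blast
  have "\<phi> k (G u' s) \<noteq> \<phi> j (G v' t)" using w(1) s t by (intro disjoint G_open)
  moreover have "G w (\<phi> k (G u' s)) = G w (\<phi> j (G v' t))" using s t w by (simp add: G_append)
  ultimately show False using s t
    by (metis G_inj G_open atLeastAtMost_iff greaterThanLessThan_iff less_imp_le maps_open)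
qed

text \<open>
  Words of lengths congruent modulo \<open>M\<close> whose cylinders have comparable sizes are incomparable
  for the prefix order, so that their cylinders are disjoint and can be packed.
\<close>

lemma cylinders_sparse:
  fixes \<kappa> :: real
  assumes "\<kappa> \<ge> 1"
  shows "\<exists>N::nat. \<forall>a. \<forall>\<rho>>0. finite {w. \<rho> \<le> diam w \<and> diam w \<le> \<kappa> * \<rho> \<and> G w 0 \<in> {a..a+\<rho>}} \<and>
    card {w. \<rho> \<le> diam w \<and> diam w \<le> \<kappa> * \<rho> \<and> G w 0 \<in> {a..a+\<rho>}} \<le> N"
proof -
  have "(\<lambda>M. K * \<kappa> * \<theta> ^ M) \<longlonglongrightarrow> K * \<kappa> * 0"
    using \<theta> by (intro tendsto_intros LIMSEQ_power_zero) auto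
  then have "\<forall>\<^sub>F M in sequentially. K * \<kappa> * \<theta> ^ M < 1" by (intro order_tendstoD) auto
  then have "\<forall>\<^sub>F M in sequentially. K * \<kappa> * \<theta> ^ M < 1 \<and> M > 0"
    by (intro eventually_conj eventually_gt_at_top)
  then obtain M where M: "K * \<kappa> * \<theta> ^ M < 1" "M > 0" by (auto simp: eventually_sequentially)
  define J where "J = \<lceil>\<kappa>\<rceil> + 2"
  define T where "T = {..<M} \<times> {-J..J}"
  have "finite W \<and> card W \<le> card T"
    if \<rho>: "\<rho> > 0" and W: "W = {w. \<rho> \<le> diam w \<and> diam w \<le> \<kappa> * \<rho> \<and> G w 0 \<in> {a..a+\<rho>}}" for a \<rho> W
  proof -
    define h where "h w = (length w mod M, \<lfloor>(G w 0 + G w 1) / 2 / \<rho>\<rfloor> - \<lfloor>a / \<rho>\<rfloor>)" for w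
    have no_prefix: "\<not> prefix u v" if "u \<in> W" "v \<in> W" "u \<noteq> v" "length u mod M = length v mod M" for u v
    proof
      assume "prefix u v"
      then obtain t where t: "v = u @ t" by (auto simp: prefix_def)
      have "length t mod M = 0" using that(4) t
        by (metis add_diff_cancel_left' length_append mod_eq_dvd_iff_nat dvd_imp_mod_0 le_add1)
      moreover have "length t > 0" using that(3) t by auto
      ultimately have "M \<le> length t" by (auto intro: dvd_imp_le)
      then have "\<theta> ^ length t \<le> \<theta> ^ M" using \<theta> by (intro power_decreasing) auto
      have "\<rho> \<le> diam v" using that W by auto
      also have "\<dots> \<le> K * \<theta> ^ length t * diam u" unfolding t by (rule diam_append)
      also have "\<dots> \<le> K * \<theta> ^ M * (\<kappa> * \<rho>)"
        using \<open>\<theta> ^ length t \<le> \<theta> ^ M\<close> that W K_pos \<theta> diam_pos[of u] \<rho> assms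
        by (intro mult_mono mult_left_mono) auto
      also have "\<dots> < 1 * \<rho>" using mult_strict_right_mono[OF M(1) \<rho>] by (simp add: mult_ac)
      finally show False by simp
    qed
    have "inj_on h W"
    proof (rule inj_onI, rule ccontr)
      fix u v assume uv: "u \<in> W" "v \<in> W" "h u = h v" "u \<noteq> v"
      then have "u \<parallel> v" using no_prefix[of u v] no_prefix[of v u] by (auto simp: h_def parallel_def)
      then have "\<lfloor>(G u 0 + G u 1) / 2 / \<rho>\<rfloor> \<noteq> \<lfloor>(G v 0 + G v 1) / 2 / \<rho>\<rfloor>"
        using uv W by (intro floor_divide_neq_of_disjoint[OF \<rho>] parallel_disjoint) (auto simp: diam_def)
      then show False using uv(3) by (simp add: h_def)
    qed
    moreover have "h ` W \<subseteq> T"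
    proof
      fix p assume "p \<in> h ` W"
      then obtain w where w: "w \<in> W" "p = h w" by blast
      define m where "m = (G w 0 + G w 1) / 2"
      have "\<bar>m - a\<bar> \<le> (\<kappa> + 1) * \<rho>"
      proof -
        have "\<bar>G w 1 - G w 0\<bar> \<le> \<kappa> * \<rho>" "a \<le> G w 0" "G w 0 \<le> a + \<rho>" using w W by (auto simp: diam_def)
        moreover have "m - a = (G w 0 - a) + (G w 1 - G w 0) / 2" by (simp add: m_def field_simps)
        moreover have "(\<kappa> + 1) * \<rho> = \<kappa> * \<rho> + \<rho>" by (simp add: algebra_simps)
        moreover have "0 \<le> \<kappa> * \<rho>" using \<rho> assms by simp
        ultimately show ?thesis using \<rho> by (auto intro!: abs_leI simp: abs_le_iff field_simps)
      qed
      then have "\<bar>m / \<rho> - a / \<rho>\<bar> \<le> \<kappa> + 1"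
        using \<rho> by (simp add: diff_divide_distrib[symmetric] abs_divide field_simps)
      then have "\<bar>\<lfloor>m / \<rho>\<rfloor> - \<lfloor>a / \<rho>\<rfloor>\<bar> \<le> J" unfolding J_def by linarith
      then show "p \<in> T" using M(2) by (auto simp: T_def w h_def m_def)
    qed
    moreover have "finite T" by (simp add: T_def)
    ultimately show ?thesis by (meson card_inj_on_le inj_on_finite)
  qed
  then show ?thesis by blast
qed

end

section \<open>Maps with a neutral fixed point\<close>

lemma ln_diff_le:
  fixes u v :: real
  assumes "1 \<le> u" "1 \<le> v"
  shows "\<bar>ln u - ln v\<bar> \<le> \<bar>u - v\<bar>"
proof -
  have *: "ln u - ln v \<le> u - v" if "1 \<le> v" "v \<le> u" for u v :: real
  proof -
    have "ln u - ln v = ln (u / v)" using that by (simp add: ln_div)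
    also have "\<dots> \<le> u / v - 1" using that by (intro ln_le_minus_one) auto
    also have "\<dots> = (u - v) / v" using that by (simp add: field_simps)
    also have "\<dots> \<le> (u - v) / 1" using that by (intro divide_left_mono) auto
    finally show ?thesis by simp
  qed
  show ?thesis
    using *[of u v] *[of v u] assms by (cases "u \<le> v") auto
qed

locale neutral_map =
  fixes f f' f'' g\<^sub>0 g\<^sub>1 :: "real \<Rightarrow> real" and r A \<gamma> D E \<mu> :: real
  assumes r: "0 < r" "r < 1"
    and maps: "x \<in> {0..1} \<Longrightarrow> f x \<in> {0..1}"
    and f_0: "f 0 = 0"
    and f_tendsto_1: "(f \<longlongrightarrow> f 1) (at_left 1)"
    and left_deriv_ge: "x \<in> {0<..<r} \<Longrightarrow> 1 \<le> f' x"
    and left_deriv_le: "x \<in> {0<..<r} \<Longrightarrow> f' x \<le> D"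
    and left_deriv2: "x \<in> {0<..<r} \<Longrightarrow> (f' has_real_derivative f'' x) (at x)"
    and A: "1 \<le> A"
    and left_deriv2_ge: "x \<in> {0<..<r} \<Longrightarrow> inverse A \<le> f'' x / x powr (\<gamma> - 1)"
    and left_deriv2_le: "x \<in> {0<..<r} \<Longrightarrow> f'' x / x powr (\<gamma> - 1) \<le> A"
    and \<mu>: "1 < \<mu>" and right_deriv_ge: "x \<in> {r<..<1} \<Longrightarrow> \<mu> \<le> \<bar>f' x\<bar>"
    and E: "0 \<le> E"
    and right_deriv_lip: "x \<in> {r<..<1} \<Longrightarrow> y \<in> {r<..<1} \<Longrightarrow> \<bar>f' x - f' y\<bar> \<le> E * \<bar>x - y\<bar>"
    and g0_open: "y \<in> {0<..<1} \<Longrightarrow> g\<^sub>0 y \<in> {0<..<r}"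
    and g0_0: "g\<^sub>0 0 = 0" and g0_1: "g\<^sub>0 1 = r"
    and g0_f: "x \<in> {0<..<r} \<Longrightarrow> g\<^sub>0 (f x) = x"
    and g0_mono: "x \<in> {0..1} \<Longrightarrow> y \<in> {0..1} \<Longrightarrow> x \<le> y \<Longrightarrow> g\<^sub>0 x \<le> g\<^sub>0 y"
    and g0_lip: "x \<in> {0..1} \<Longrightarrow> y \<in> {0..1} \<Longrightarrow> x \<le> y \<Longrightarrow> g\<^sub>0 y - g\<^sub>0 x \<le> y - x"
    and g0_deriv: "y \<in> {0<..<1} \<Longrightarrow> (g\<^sub>0 has_real_derivative inverse (f' (g\<^sub>0 y))) (at y)"
    and f_g0: "y \<in> {0<..<1} \<Longrightarrow> f (g\<^sub>0 y) = y"
    and g1_open: "y \<in> {0<..<1} \<Longrightarrow> g\<^sub>1 y \<in> {r<..<1}"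
    and g1_ends: "g\<^sub>1 0 = r \<and> g\<^sub>1 1 = 1 \<or> g\<^sub>1 0 = 1 \<and> g\<^sub>1 1 = r"
    and g1_f: "x \<in> {r<..<1} \<Longrightarrow> g\<^sub>1 (f x) = x"
    and g1_lip: "x \<in> {0..1} \<Longrightarrow> y \<in> {0..1} \<Longrightarrow> \<bar>g\<^sub>1 x - g\<^sub>1 y\<bar> \<le> \<bar>x - y\<bar>"
    and g1_deriv: "y \<in> {0<..<1} \<Longrightarrow> (g\<^sub>1 has_real_derivative inverse (f' (g\<^sub>1 y))) (at y)"
begin

lemma g0_cont: "continuous_on {0..1} g\<^sub>0"
proof -
  have "1-lipschitz_on {0..1} g\<^sub>0"
  proof (rule lipschitz_onI)
    fix x y :: real assume "x \<in> {0..1}" "y \<in> {0..1}"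
    then show "dist (g\<^sub>0 x) (g\<^sub>0 y) \<le> 1 * dist x y"
      using g0_lip[of x y] g0_lip[of y x] g0_mono[of x y] g0_mono[of y x]
      by (cases "x \<le> y") (auto simp: dist_real_def)
  qed simp
  then show ?thesis by (rule lipschitz_on_continuous_on)
qed

lemma g1_cont: "continuous_on {0..1} g\<^sub>1"
proof -
  have "1-lipschitz_on {0..1} g\<^sub>1"
    by (rule lipschitz_onI) (use g1_lip in \<open>auto simp: dist_real_def\<close>)
  then show ?thesis by (rule lipschitz_on_continuous_on)
qed

lemma g0_closed: "y \<in> {0..1} \<Longrightarrow> g\<^sub>0 y \<in> {0..1}"
  using g0_mono[of 0 y] g0_mono[of y 1] g0_0 g0_1 r by auto

lemma g1_closed: "y \<in> {0..1} \<Longrightarrow> g\<^sub>1 y \<in> {0..1}"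
  using g1_open[of y] g1_ends r by (cases "y = 0 \<or> y = 1") auto

lemma g0_le: "y \<in> {0..1} \<Longrightarrow> g\<^sub>0 y \<le> y"
  using g0_lip[of 0 y] g0_0 by auto

lemma iter_closed: "x \<in> {0..1} \<Longrightarrow> (g\<^sub>0 ^^ j) x \<in> {0..1}"
  by (induction j) (use g0_closed in auto)

lemma iter_open: "x \<in> {0<..<1} \<Longrightarrow> (g\<^sub>0 ^^ j) x \<in> {0<..<1}"
proof (induction j)
  case (Suc j)
  then show ?case using g0_open[of "(g\<^sub>0 ^^ j) x"] r by auto
qed simp

lemma iter_left: "x \<in> {0<..<1} \<Longrightarrow> (g\<^sub>0 ^^ Suc j) x \<in> {0<..<r}"
  using g0_open[OF iter_open] by simp

lemma iter_mono: "x \<in> {0..1} \<Longrightarrow> y \<in> {0..1} \<Longrightarrow> x \<le> y \<Longrightarrow> (g\<^sub>0 ^^ j) x \<le> (g\<^sub>0 ^^ j) y"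
  by (induction j) (use g0_mono iter_closed in auto)

lemma iter_le: "x \<in> {0..1} \<Longrightarrow> (g\<^sub>0 ^^ j) x \<le> x"
proof (induction j)
  case (Suc j)
  then show ?case using g0_le[OF iter_closed, of x j] by auto
qed simp

lemma iter_cont: "continuous_on {0..1} (g\<^sub>0 ^^ j)"
proof (induction j)
  case (Suc j)
  have "continuous_on {0..1} (\<lambda>x. g\<^sub>0 ((g\<^sub>0 ^^ j) x))"
    by (rule continuous_on_compose2[OF g0_cont Suc.IH]) (use iter_closed in blast)
  then show ?case by (simp add: o_def)
qed (simp add: id_def)

definition iter' :: "nat \<Rightarrow> real \<Rightarrow> real" where
  "iter' k x = (\<Prod>j<k. inverse (f' ((g\<^sub>0 ^^ Suc j) x)))"

lemma iter'_Suc: "iter' (Suc k) x = iter' k x * inverse (f' ((g\<^sub>0 ^^ Suc k) x))"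
  by (simp add: iter'_def)

lemma iter_deriv_pos: "x \<in> {0<..<1} \<Longrightarrow> 0 < iter' k x"
  unfolding iter'_def
proof (rule prod_pos)
  fix j assume "x \<in> {0<..<1}"
  then show "0 < inverse (f' ((g\<^sub>0 ^^ Suc j) x))" using left_deriv_ge[OF iter_left, of x j] by simp
qed

lemma iter_deriv: "x \<in> {0<..<1} \<Longrightarrow> ((g\<^sub>0 ^^ k) has_real_derivative iter' k x) (at x)"
proof (induction k)
  case (Suc k)
  from DERIV_chain2[OF g0_deriv[OF iter_open[OF Suc.prems]] Suc.IH[OF Suc.prems]]
  show ?case by (simp add: iter'_Suc o_def mult.commute)
qed (simp add: iter'_def id_def)

lemma iter_deriv_le1: "x \<in> {0<..<1} \<Longrightarrow> iter' k x \<le> 1"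
  unfolding iter'_def
proof (rule prod_le_1)
  fix j assume "x \<in> {0<..<1}"
  then show "0 \<le> inverse (f' ((g\<^sub>0 ^^ Suc j) x)) \<and> inverse (f' ((g\<^sub>0 ^^ Suc j) x)) \<le> 1"
    using left_deriv_ge[OF iter_left, of x j] by (simp add: inverse_le_1_iff)
qed

lemma D_ge1: "1 \<le> D"
  using left_deriv_ge[of "r/2"] left_deriv_le[of "r/2"] r by auto

lemma left_deriv2_pos:
  assumes x: "x \<in> {0<..<r}"
  shows "0 < f'' x"
proof -
  have "0 < inverse A" using A by simp
  also have "\<dots> \<le> f'' x / x powr (\<gamma> - 1)" by (rule left_deriv2_ge[OF x])
  finally show ?thesis using x by (simp add: zero_less_divide_iff)
qed

lemma left_deriv_mono:
  assumes "p \<in> {0<..<r}" "q \<in> {0<..<r}" "p \<le> q"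
  shows "f' p \<le> f' q"
proof (rule DERIV_nonneg_imp_nondecreasing[OF assms(3)])
  fix x assume "p \<le> x" "x \<le> q"
  then have "x \<in> {0<..<r}" using assms by auto
  then show "\<exists>y. (f' has_real_derivative y) (at x) \<and> 0 \<le> y"
    using left_deriv2 left_deriv2_pos by (meson less_imp_le)
qed

lemma iter_deriv_antimono:
  assumes "p \<in> {0<..<1}" "q \<in> {0<..<1}" "p \<le> q"
  shows "iter' k q \<le> iter' k p"
  unfolding iter'_def
proof (rule prod_mono)
  fix j
  have "f' ((g\<^sub>0 ^^ Suc j) p) \<le> f' ((g\<^sub>0 ^^ Suc j) q)"
    using assms by (intro left_deriv_mono iter_left iter_mono) auto
  then show "0 \<le> inverse (f' ((g\<^sub>0 ^^ Suc j) q)) \<and>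
      inverse (f' ((g\<^sub>0 ^^ Suc j) q)) \<le> inverse (f' ((g\<^sub>0 ^^ Suc j) p))"
    using left_deriv_ge[OF iter_left[OF assms(1), of j]] left_deriv_ge[OF iter_left[OF assms(2), of j]]
    by (auto intro: le_imp_inverse_le)
qed

text \<open>
  The intervals \<open>[g\<^sub>0\<^sup>j\<^sup>+\<^sup>1 x, g\<^sub>0\<^sup>j x]\<close> do not overlap and \<open>f'\<close> is monotone on \<open>(0,r)\<close>, so the
  distortion telescopes.
\<close>

lemma iter_deriv_telescope:
  assumes x: "x \<in> {0<..<1}"
  shows "iter' k (g\<^sub>0 x) * f' ((g\<^sub>0 ^^ Suc k) x) = f' (g\<^sub>0 x) * iter' k x"
proof (induction k)
  case (Suc k)
  have nz: "f' ((g\<^sub>0 ^^ Suc j) x) \<noteq> 0" for j using left_deriv_ge[OF iter_left[OF x, of j]] by auto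
  have sw: "(g\<^sub>0 ^^ Suc k) (g\<^sub>0 x) = (g\<^sub>0 ^^ Suc (Suc k)) x" by (simp add: funpow_swap1)
  have "iter' (Suc k) (g\<^sub>0 x) * f' ((g\<^sub>0 ^^ Suc (Suc k)) x) = iter' k (g\<^sub>0 x)"
    unfolding iter'_Suc sw using nz[of "Suc k"] by simp
  also have "\<dots> = f' (g\<^sub>0 x) * iter' k x * inverse (f' ((g\<^sub>0 ^^ Suc k) x))"
    using Suc nz[of k] by (simp add: field_simps)
  finally show ?case by (simp add: iter'_Suc)
qed (simp add: iter'_def)

lemma iter_deriv_ratio:
  assumes x: "x \<in> {0<..<1}" and p: "p \<in> {g\<^sub>0 x..x}" and q: "q \<in> {g\<^sub>0 x..x}"
  shows "iter' k p \<le> D * iter' k q"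
proof -
  have g: "g\<^sub>0 x \<in> {0<..<1}" using iter_open[OF x, of 1] by simp
  have pq: "p \<in> {0<..<1}" "q \<in> {0<..<1}" using g x p q by auto
  have "iter' k p \<le> iter' k (g\<^sub>0 x)" using p by (intro iter_deriv_antimono g pq) auto
  also have "\<dots> \<le> iter' k (g\<^sub>0 x) * f' ((g\<^sub>0 ^^ Suc k) x)"
    using left_deriv_ge[OF iter_left[OF x, of k]] iter_deriv_pos[OF g, of k] by simp
  also have "\<dots> = f' (g\<^sub>0 x) * iter' k x" by (rule iter_deriv_telescope[OF x])
  also have "\<dots> \<le> D * iter' k q"
    using left_deriv_le[OF g0_open[OF x]] iter_deriv_antimono[OF pq(2) x, of k] iter_deriv_pos[OF x, of k] D_ge1 q
    by (intro mult_mono) auto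
  finally show ?thesis .
qed

lemma iter_distortion:
  assumes x: "x \<in> {0<..<1}" and p: "p \<in> {g\<^sub>0 x..x}" and lt: "g\<^sub>0 x < x"
  shows "(g\<^sub>0 ^^ k) x - (g\<^sub>0 ^^ k) p \<le> D * (x - p) / (x - g\<^sub>0 x) * ((g\<^sub>0 ^^ k) x - (g\<^sub>0 ^^ Suc k) x)"
proof (cases "p = x")
  case False
  then have "p < x" using p by auto
  have g: "g\<^sub>0 x \<in> {0<..<1}" using iter_open[OF x, of 1] by simp
  have d: "((g\<^sub>0 ^^ k) has_real_derivative iter' k t) (at t)" if "g\<^sub>0 x \<le> t" "t \<le> x" for t
    using that g x by (intro iter_deriv) auto
  obtain \<xi> where \<xi>: "p < \<xi>" "\<xi> < x" "(g\<^sub>0 ^^ k) x - (g\<^sub>0 ^^ k) p = (x - p) * iter' k \<xi>"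
    using MVT2[OF \<open>p < x\<close>, of "g\<^sub>0 ^^ k" "iter' k"] d p by auto
  obtain \<eta> where \<eta>: "g\<^sub>0 x < \<eta>" "\<eta> < x" "(g\<^sub>0 ^^ k) x - (g\<^sub>0 ^^ k) (g\<^sub>0 x) = (x - g\<^sub>0 x) * iter' k \<eta>"
    using MVT2[OF lt, of "g\<^sub>0 ^^ k" "iter' k"] d by auto
  have eq: "iter' k \<eta> = ((g\<^sub>0 ^^ k) x - (g\<^sub>0 ^^ Suc k) x) / (x - g\<^sub>0 x)"
    using \<eta>(3) lt by (simp add: funpow_swap1)
  have "iter' k \<xi> \<le> D * iter' k \<eta>" using \<xi> \<eta> p by (intro iter_deriv_ratio[OF x]) auto
  then have "(x - p) * iter' k \<xi> \<le> (x - p) * (D * iter' k \<eta>)" using \<open>p < x\<close> by (intro mult_left_mono) auto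
  then show ?thesis unfolding \<xi>(3) eq by (simp add: mult_ac)
qed simp

lemma le_D_g0:
  assumes y: "y \<in> {0<..<1}"
  shows "y \<le> D * g\<^sub>0 y"
proof -
  have "continuous_on {0..y} g\<^sub>0" using g0_cont y by (auto intro: continuous_on_subset)
  then obtain z where z: "0 < z" "z < y" "g\<^sub>0 y - g\<^sub>0 0 = inverse (f' (g\<^sub>0 z)) * (y - 0)"
    by (rule mvt[rotated, where f' = "\<lambda>z d. inverse (f' (g\<^sub>0 z)) * d"])
      (use y g0_deriv in \<open>auto simp: has_field_derivative_def[symmetric]\<close>)
  have "g\<^sub>0 z \<in> {0<..<r}" using z y by (intro g0_open) auto
  then have f': "1 \<le> f' (g\<^sub>0 z)" "f' (g\<^sub>0 z) \<le> D" using left_deriv_ge left_deriv_le by auto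
  then have "y = f' (g\<^sub>0 z) * g\<^sub>0 y" using z(3) g0_0 by (simp add: field_simps)
  also have "\<dots> \<le> D * g\<^sub>0 y" using f' g0_open[OF y] by (intro mult_right_mono) auto
  finally show ?thesis .
qed

definition H :: real where
  "H = A * A * D powr \<bar>\<gamma> - 1\<bar>"

lemma H_nonneg: "0 \<le> H"
  using A by (simp add: H_def)

lemma left_deriv2_comparable:
  assumes t: "t \<in> {0<..<r}" and s: "s \<in> {0<..<r}" and ts: "t \<le> D * s" and st: "s \<le> D * t"
  shows "f'' t \<le> H * f'' s"
proof -
  have "(t / s) powr (\<gamma> - 1) \<le> D powr \<bar>\<gamma> - 1\<bar>"
  proof (cases "1 \<le> \<gamma>")
    case True
    then have "(t / s) powr (\<gamma> - 1) \<le> D powr (\<gamma> - 1)"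
      using ts t s by (intro powr_mono2) (auto simp: field_simps)
    then show ?thesis using True by simp
  next
    case False
    have "(t / s) powr (\<gamma> - 1) = (s / t) powr (1 - \<gamma>)"
      using t s by (simp add: powr_divide powr_diff field_simps)
    also have "\<dots> \<le> D powr (1 - \<gamma>)"
      using st t s False by (intro powr_mono2) (auto simp: field_simps)
    finally show ?thesis using False by simp
  qed
  then have "t powr (\<gamma> - 1) \<le> D powr \<bar>\<gamma> - 1\<bar> * s powr (\<gamma> - 1)"
    using t s by (simp add: powr_divide field_simps)
  moreover have "s powr (\<gamma> - 1) \<le> A * f'' s"
    using left_deriv2_ge[OF s] s A by (simp add: field_simps)
  moreover have "f'' t \<le> A * t powr (\<gamma> - 1)"
    using left_deriv2_le[OF t] t by (simp add: field_simps)
  ultimately have "f'' t \<le> A * (D powr \<bar>\<gamma> - 1\<bar> * (A * f'' s))"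
    using A by (smt (verit, best) mult_left_mono powr_ge_zero)
  then show ?thesis by (simp add: H_def mult_ac)
qed

lemma left_deriv_increment:
  assumes x: "x \<in> {0<..<1}" and p: "p \<in> {g\<^sub>0 x..x}" and lt: "g\<^sub>0 x < x"
  shows "f' ((g\<^sub>0 ^^ Suc j) x) - f' ((g\<^sub>0 ^^ Suc j) p) \<le>
    H * D * (x - p) / (x - g\<^sub>0 x) * (f' ((g\<^sub>0 ^^ Suc j) x) - f' ((g\<^sub>0 ^^ Suc (Suc j)) x))"
proof -
  define a b c where "a = (g\<^sub>0 ^^ Suc (Suc j)) x" and "b = (g\<^sub>0 ^^ Suc j) p" and "c = (g\<^sub>0 ^^ Suc j) x"
  have px: "p \<in> {0<..<1}" using p x g0_open[OF x] by auto
  have "(g\<^sub>0 ^^ Suc j) (g\<^sub>0 x) \<le> b" "b \<le> c"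
    unfolding b_def c_def by (rule iter_mono; use x p px g0_open[OF x] r in auto)+
  then have abc: "a \<le> b" "b \<le> c" unfolding a_def by (simp_all add: funpow_swap1)
  have left: "a \<in> {0<..<r}" "b \<in> {0<..<r}" "c \<in> {0<..<r}"
    unfolding a_def b_def c_def by (rule iter_left; use x px in auto)+
  have \<kappa>: "0 \<le> H * D * (x - p) / (x - g\<^sub>0 x)" using H_nonneg D_ge1 p lt by simp
  have "f' c - f' b \<le> H * D * (x - p) / (x - g\<^sub>0 x) * (f' c - f' a)"
  proof (cases "b = c")
    case True
    have "0 \<le> H * D * (x - p) / (x - g\<^sub>0 x) * (f' c - f' a)"
      using left_deriv_mono[OF left(1,3)] abc by (intro mult_nonneg_nonneg \<kappa>) auto
    then show ?thesis using True by simp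
  next
    case False
    then have bc: "b < c" and ac: "a < c" using abc by auto
    have d: "(f' has_real_derivative f'' t) (at t)" if "a \<le> t" "t \<le> c" for t
      using that left by (intro left_deriv2) auto
    obtain t where t: "b < t" "t < c" "f' c - f' b = (c - b) * f'' t"
      using MVT2[OF bc, of f' f''] d abc by auto
    obtain s where s: "a < s" "s < c" "f' c - f' a = (c - a) * f'' s"
      using MVT2[OF ac, of f' f''] d by auto
    have "c \<le> D * a" using le_D_g0[of c] left(3) r unfolding a_def c_def by simp
    moreover have "D * a \<le> D * t" "D * a \<le> D * s" using D_ge1 abc t s by simp_all
    moreover have "t \<le> c" "s \<le> c" using t s by simp_all
    ultimately have "t \<le> D * s" "s \<le> D * t" by linarith+
    then have f2: "f'' t \<le> H * f'' s" using left abc t s by (intro left_deriv2_comparable) auto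
    have "0 < f'' s" using left s by (intro left_deriv2_pos) auto
    have "f' c - f' b \<le> (c - b) * (H * f'' s)" unfolding t(3) using f2 bc by (intro mult_left_mono) auto
    also have "\<dots> \<le> D * (x - p) / (x - g\<^sub>0 x) * (c - a) * (H * f'' s)"
      using iter_distortion[OF x p lt, of "Suc j"] H_nonneg \<open>0 < f'' s\<close>
      unfolding a_def[symmetric] b_def[symmetric] c_def[symmetric]
      by (intro mult_right_mono) auto
    also have "\<dots> = H * D * (x - p) / (x - g\<^sub>0 x) * (f' c - f' a)"
      unfolding s(3) by simp
    finally show ?thesis .
  qed
  then show ?thesis unfolding a_def b_def c_def .
qed

lemma ln_iter_deriv:
  assumes x: "x \<in> {0<..<1}"
  shows "ln (iter' k x) = - (\<Sum>j<k. ln (f' ((g\<^sub>0 ^^ Suc j) x)))"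
proof (induction k)
  case (Suc k)
  have "1 \<le> f' ((g\<^sub>0 ^^ Suc k) x)" by (rule left_deriv_ge[OF iter_left[OF x]])
  then show ?case using Suc iter_deriv_pos[OF x, of k]
    by (simp add: iter'_Suc ln_mult ln_inverse)
qed (simp add: iter'_def)

lemma iter_log_distortion:
  assumes x: "x \<in> {0<..<1}" and p: "p \<in> {g\<^sub>0 x..x}" and lt: "g\<^sub>0 x < x"
  shows "\<bar>ln (iter' k p) - ln (iter' k x)\<bar> \<le> H * D * D / (x - g\<^sub>0 x) * (x - p)"
proof -
  have px: "p \<in> {0<..<1}" using p x g0_open[OF x] by auto
  define F where "F j = f' ((g\<^sub>0 ^^ Suc j) x)" for j
  have Fge: "1 \<le> F j" for j unfolding F_def by (rule left_deriv_ge[OF iter_left[OF x]])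
  have \<kappa>: "0 \<le> H * D * (x - p) / (x - g\<^sub>0 x)" using H_nonneg D_ge1 p lt by simp
  have "iter' k x \<le> iter' k p" using p by (intro iter_deriv_antimono px x) auto
  then have "\<bar>ln (iter' k p) - ln (iter' k x)\<bar> = ln (iter' k p) - ln (iter' k x)"
    using iter_deriv_pos[OF x, of k] by simp
  also have "\<dots> = (\<Sum>j<k. ln (F j) - ln (f' ((g\<^sub>0 ^^ Suc j) p)))"
    unfolding ln_iter_deriv[OF x] ln_iter_deriv[OF px] F_def by (simp add: sum_subtractf)
  also have "\<dots> \<le> (\<Sum>j<k. H * D * (x - p) / (x - g\<^sub>0 x) * (F j - F (Suc j)))"
  proof (rule sum_mono)
    fix j
    have "f' ((g\<^sub>0 ^^ Suc j) p) \<le> F j"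
      unfolding F_def by (intro left_deriv_mono iter_left iter_mono) (use x px p in auto)
    then have "ln (F j) - ln (f' ((g\<^sub>0 ^^ Suc j) p)) \<le> F j - f' ((g\<^sub>0 ^^ Suc j) p)"
      using ln_diff_le[OF Fge[of j] left_deriv_ge[OF iter_left[OF px, of j]]] by linarith
    also have "\<dots> \<le> H * D * (x - p) / (x - g\<^sub>0 x) * (F j - F (Suc j))"
      unfolding F_def by (rule left_deriv_increment[OF x p lt])
    finally show "ln (F j) - ln (f' ((g\<^sub>0 ^^ Suc j) p)) \<le> H * D * (x - p) / (x - g\<^sub>0 x) * (F j - F (Suc j))" .
  qed
  also have "\<dots> = H * D * (x - p) / (x - g\<^sub>0 x) * (F 0 - F k)"
    by (simp only: sum_distrib_left[symmetric] sum_lessThan_telescope')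
  also have "\<dots> \<le> H * D * (x - p) / (x - g\<^sub>0 x) * D"
    using left_deriv_le[OF iter_left[OF x, of 0]] Fge[of k] by (intro mult_left_mono \<kappa>) (simp add: F_def)
  finally show ?thesis by (simp add: mult_ac)
qed

definition \<delta> :: real where
  "\<delta> = r - g\<^sub>0 r"

lemma \<delta>_pos: "0 < \<delta>"
  using g0_open[of r] r by (simp add: \<delta>_def)

lemma iter_log_lipschitz:
  assumes "x \<in> {r<..<1}" "y \<in> {r<..<1}"
  shows "\<bar>ln (iter' k x) - ln (iter' k y)\<bar> \<le> H * D * D / \<delta> * \<bar>x - y\<bar>"
proof -
  have *: "\<bar>ln (iter' k p) - ln (iter' k x)\<bar> \<le> H * D * D / \<delta> * (x - p)"
    if "x \<in> {r<..<1}" "p \<in> {r<..<1}" "p \<le> x" for x p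
  proof -
    have "\<delta> \<le> x - g\<^sub>0 x" using g0_lip[of r x] that r by (auto simp: \<delta>_def)
    moreover have "g\<^sub>0 x \<le> r" using g0_mono[of x 1] g0_1 that r by auto
    ultimately have "\<bar>ln (iter' k p) - ln (iter' k x)\<bar> \<le> H * D * D / (x - g\<^sub>0 x) * (x - p)"
      using that r \<delta>_pos by (intro iter_log_distortion) auto
    also have "\<dots> \<le> H * D * D / \<delta> * (x - p)"
      using \<open>\<delta> \<le> x - g\<^sub>0 x\<close> \<delta>_pos H_nonneg D_ge1 that by (intro mult_right_mono divide_left_mono) auto
    finally show ?thesis .
  qed
  show ?thesis
    using *[of x y] *[of y x] assms by (cases "x \<le> y") (auto simp: abs_minus_commute)
qed

definition \<phi> :: "nat \<Rightarrow> real \<Rightarrow> real" where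
  "\<phi> k y = (g\<^sub>0 ^^ k) (g\<^sub>1 y)"

definition \<phi>' :: "nat \<Rightarrow> real \<Rightarrow> real" where
  "\<phi>' k y = iter' k (g\<^sub>1 y) * inverse (f' (g\<^sub>1 y))"

lemma iter_disjoint:
  assumes "k < j" "x \<in> {r<..<1}" "y \<in> {0<..<1}"
  shows "(g\<^sub>0 ^^ k) x \<noteq> (g\<^sub>0 ^^ j) y"
  using assms(1)
proof (induction k arbitrary: j)
  case 0
  then obtain i where "j = Suc i" by (cases j) auto
  then show ?case using iter_left[OF assms(3), of i] assms(2) by auto
next
  case (Suc k)
  then obtain i where i: "j = Suc i" "k < i" by (cases j) auto
  have x: "x \<in> {0<..<1}" using assms(2) r by auto
  have "f ((g\<^sub>0 ^^ Suc k) x) = (g\<^sub>0 ^^ k) x" "f ((g\<^sub>0 ^^ Suc i) y) = (g\<^sub>0 ^^ i) y"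
    using f_g0[OF iter_open[OF x]] f_g0[OF iter_open[OF assms(3)]] by simp_all
  then show ?case using Suc.IH[OF i(2)] i(1) by metis
qed

sublocale conformal_ifs \<phi> \<phi>' "1 / \<mu>" "H * D * D / \<delta> + E"
proof
  have g1_01: "g\<^sub>1 y \<in> {0<..<1}" if "y \<in> {0<..<1}" for y using g1_open[OF that] r by auto
  show "0 < 1 / \<mu>" "1 / \<mu> < 1" using \<mu> by auto
  show "0 \<le> H * D * D / \<delta> + E" using H_nonneg D_ge1 \<delta>_pos E by simp
  show "\<phi> k y \<in> {0..1}" if "y \<in> {0..1}" for k y
    unfolding \<phi>_def by (intro iter_closed g1_closed that)
  show "\<phi> k y \<in> {0<..<1}" if "y \<in> {0<..<1}" for k y
    unfolding \<phi>_def by (intro iter_open g1_01 that)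
  show "continuous_on {0..1} (\<phi> k)" for k
    unfolding \<phi>_def by (rule continuous_on_compose2[OF iter_cont g1_cont]) (use g1_closed in blast)
  show "(\<phi> k has_real_derivative \<phi>' k y) (at y)" if "y \<in> {0<..<1}" for k y
    using DERIV_chain2[OF iter_deriv[OF g1_01[OF that]] g1_deriv[OF that]]
    by (simp add: \<phi>_def[abs_def] \<phi>'_def)
  show "\<phi>' k y \<noteq> 0" if "y \<in> {0<..<1}" for k y
    using iter_deriv_pos[OF g1_01[OF that], of k] right_deriv_ge[OF g1_open[OF that]] \<mu>
    by (auto simp: \<phi>'_def)
  show "\<bar>\<phi>' k y\<bar> \<le> 1 / \<mu>" if "y \<in> {0<..<1}" for k y
  proof -
    have "inverse \<bar>f' (g\<^sub>1 y)\<bar> \<le> inverse \<mu>"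
      using right_deriv_ge[OF g1_open[OF that]] \<mu> by (intro le_imp_inverse_le) auto
    then have "\<bar>iter' k (g\<^sub>1 y)\<bar> * inverse \<bar>f' (g\<^sub>1 y)\<bar> \<le> 1 * inverse \<mu>"
      using iter_deriv_pos[OF g1_01[OF that], of k] iter_deriv_le1[OF g1_01[OF that], of k]
      by (intro mult_mono) auto
    then show ?thesis by (simp add: \<phi>'_def abs_mult inverse_eq_divide)
  qed
  show "\<bar>ln \<bar>\<phi>' k x\<bar> - ln \<bar>\<phi>' k y\<bar>\<bar> \<le> (H * D * D / \<delta> + E) * \<bar>x - y\<bar>"
    if xy: "x \<in> {0<..<1}" "y \<in> {0<..<1}" for k x y
  proof -
    have ln: "ln \<bar>\<phi>' k t\<bar> = ln (iter' k (g\<^sub>1 t)) - ln \<bar>f' (g\<^sub>1 t)\<bar>" if "t \<in> {0<..<1}" for t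
      using iter_deriv_pos[OF g1_01[OF that], of k] right_deriv_ge[OF g1_open[OF that]] \<mu>
      by (simp add: \<phi>'_def abs_mult ln_mult ln_inverse)
    have "\<bar>ln \<bar>f' (g\<^sub>1 x)\<bar> - ln \<bar>f' (g\<^sub>1 y)\<bar>\<bar> \<le> \<bar>\<bar>f' (g\<^sub>1 x)\<bar> - \<bar>f' (g\<^sub>1 y)\<bar>\<bar>"
      using right_deriv_ge[OF g1_open[OF xy(1)]] right_deriv_ge[OF g1_open[OF xy(2)]] \<mu>
      by (intro ln_diff_le) auto
    also have "\<dots> \<le> \<bar>f' (g\<^sub>1 x) - f' (g\<^sub>1 y)\<bar>" by (rule abs_triangle_ineq3)
    also have "\<dots> \<le> E * \<bar>g\<^sub>1 x - g\<^sub>1 y\<bar>" by (intro right_deriv_lip g1_open xy)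
    finally have "\<bar>ln \<bar>\<phi>' k x\<bar> - ln \<bar>\<phi>' k y\<bar>\<bar> \<le> (H * D * D / \<delta> + E) * \<bar>g\<^sub>1 x - g\<^sub>1 y\<bar>"
      using iter_log_lipschitz[OF g1_open[OF xy(1)] g1_open[OF xy(2)], of k]
      unfolding ln[OF xy(1)] ln[OF xy(2)] distrib_right by linarith
    also have "\<dots> \<le> (H * D * D / \<delta> + E) * \<bar>x - y\<bar>"
      using xy H_nonneg D_ge1 \<delta>_pos E by (intro mult_left_mono g1_lip) auto
    finally show ?thesis .
  qed
  show "\<phi> k x \<noteq> \<phi> j y" if "k \<noteq> j" "x \<in> {0<..<1}" "y \<in> {0<..<1}" for k j x y
    using iter_disjoint[of k j "g\<^sub>1 x" "g\<^sub>1 y"] iter_disjoint[of j k "g\<^sub>1 y" "g\<^sub>1 x"]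
      g1_open g1_01 that unfolding \<phi>_def by (metis linorder_neq_iff)
qed

lemma g1_f_closed:
  assumes "x \<in> {r<..1}"
  shows "g\<^sub>1 (f x) = x"
proof (cases "x = 1")
  case True
  have "\<forall>\<^sub>F t in at_left 1. t \<in> {r<..<1}" using r by (simp add: eventually_at_left_field) blast
  then have ev: "\<forall>\<^sub>F t in at_left 1. f t \<in> {0..1} \<and> g\<^sub>1 (f t) = t"
    by eventually_elim (use maps g1_f r in auto)
  have "((\<lambda>t. g\<^sub>1 (f t)) \<longlongrightarrow> g\<^sub>1 (f 1)) (at_left 1)"
    by (rule continuous_on_tendsto_compose[OF g1_cont f_tendsto_1])
       (use maps[of 1] ev in \<open>auto elim: eventually_mono\<close>)
  then have "((\<lambda>t. t) \<longlongrightarrow> g\<^sub>1 (f 1)) (at_left 1)"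
    by (rule Lim_transform_eventually) (use ev in \<open>auto elim: eventually_mono\<close>)
  moreover have "((\<lambda>t. t) \<longlongrightarrow> 1) (at_left (1::real))" by (rule tendsto_ident_at)
  ultimately have "g\<^sub>1 (f 1) = 1" using tendsto_unique trivial_limit_at_left_real by blast
  then show ?thesis using True by simp
qed (use assms g1_f in auto)

lemma r_is_preimage: "\<exists>k. (g\<^sub>0 ^^ k) (g\<^sub>1 0) = r"
  using g1_ends g0_1 by (auto intro: exI[of _ 0] exI[of _ 1])

lemma orbit_avoids_0I:
  assumes x: "x \<in> {0..1}" and \<epsilon>: "\<epsilon> > 0" and far: "\<And>w. \<epsilon> * diam w \<le> \<bar>x - G w 0\<bar>"
  shows "x \<in> orbit_avoids_0 f"
proof -
  have ne: "x \<noteq> G w 0" for w using far[of w] diam_pos[of w] mult_pos_pos[OF \<epsilon> diam_pos[of w]] by auto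
  have code: "\<exists>w k. (f ^^ n) x \<in> {0..1} \<and> x = G w ((g\<^sub>0 ^^ k) ((f ^^ n) x))" for n
  proof (induction n)
    case 0
    show ?case using x by (intro exI[of _ "[]"] exI[of _ 0]) simp
  next
    case (Suc n)
    define t where "t = (f ^^ n) x"
    from Suc obtain w k where t: "t \<in> {0..1}" and xw: "x = G w ((g\<^sub>0 ^^ k) t)" unfolding t_def by blast
    have ft: "f t \<in> {0..1}" by (rule maps[OF t])
    have Suc_n: "(f ^^ Suc n) x = f t" by (simp add: t_def)
    obtain m where m: "(g\<^sub>0 ^^ m) (g\<^sub>1 0) = r" using r_is_preimage by blast
    have "t \<noteq> r"
    proof
      assume "t = r"
      then have "x = G (w @ [k + m]) 0" using xw m by (simp add: G_append \<phi>_def funpow_add)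
      then show False using ne by blast
    qed
    then consider "t = 0" | "t \<in> {0<..<r}" | "t \<in> {r<..1}" using t by force
    then show ?case
    proof cases
      case 1
      then show ?thesis unfolding Suc_n using xw f_0 by auto
    next
      case 2
      then have "x = G w ((g\<^sub>0 ^^ Suc k) (f t))" using xw g0_f[OF 2] by (simp add: funpow_swap1)
      then show ?thesis unfolding Suc_n using ft by blast
    next
      case 3
      then have "x = G (w @ [k]) ((g\<^sub>0 ^^ 0) (f t))" using xw g1_f_closed[OF 3] by (simp add: G_append \<phi>_def)
      then show ?thesis unfolding Suc_n using ft by blast
    qed
  qed
  have "\<epsilon> / K \<le> (f ^^ n) x" for n
  proof -
    obtain w k where t: "(f ^^ n) x \<in> {0..1}" and xw: "x = G w ((g\<^sub>0 ^^ k) ((f ^^ n) x))"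
      using code by blast
    define y where "y = (g\<^sub>0 ^^ k) ((f ^^ n) x)"
    have y: "y \<in> {0..1}" "y \<le> (f ^^ n) x" using iter_closed[OF t] iter_le[OF t] by (auto simp: y_def)
    have "\<epsilon> * diam w \<le> \<bar>G w y - G w 0\<bar>" using far[of w] xw by (simp add: y_def)
    also have "\<dots> \<le> K * \<bar>y - 0\<bar> * diam w" using y by (intro bounded_distortion) auto
    finally have "\<epsilon> \<le> K * y" using diam_pos[of w] y(1) by simp
    then have "\<epsilon> / K \<le> y" using K_pos by (simp add: field_simps)
    then show ?thesis using y(2) by simp
  qed
  then have "{0..<\<epsilon> / K} \<inter> range (\<lambda>n. (f ^^ n) x) = {}" by (auto simp: not_less[symmetric])
  then show ?thesis using x \<epsilon> K_pos unfolding orbit_avoids_0_def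
    by (auto intro!: exI[of _ "\<epsilon> / K"])
qed

end

lemma uniform_expansion_of_limit:
  fixes h :: "real \<Rightarrow> real"
  assumes cont: "continuous_on {r<..b} h" and gt: "\<And>x. x \<in> {r<..b} \<Longrightarrow> 1 < \<bar>h x\<bar>"
    and lim: "(h \<longlongrightarrow> l) (at_right r)" and l: "1 < \<bar>l\<bar>"
  obtains \<mu> where "1 < \<mu>" "\<And>x. x \<in> {r<..b} \<Longrightarrow> \<mu> \<le> \<bar>h x\<bar>"
proof -
  define m where "m = (1 + \<bar>l\<bar>) / 2"
  have m: "1 < m" "m < \<bar>l\<bar>" using l by (auto simp: m_def)
  have "\<forall>\<^sub>F x in at_right r. m < \<bar>h x\<bar>" by (rule order_tendstoD(1)[OF tendsto_rabs[OF lim] m(2)])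
  then obtain c where c: "r < c" "\<And>x. r < x \<Longrightarrow> x < c \<Longrightarrow> m < \<bar>h x\<bar>"
    by (auto simp: eventually_at_right_field)
  show thesis
  proof (cases "c \<le> b")
    case True
    have "\<exists>x\<in>{c..b}. \<forall>y\<in>{c..b}. \<bar>h x\<bar> \<le> \<bar>h y\<bar>"
      using True c(1) by (intro continuous_attains_inf continuous_on_rabs continuous_on_subset[OF cont]) auto
    then obtain x where x: "x \<in> {c..b}" "\<And>y. y \<in> {c..b} \<Longrightarrow> \<bar>h x\<bar> \<le> \<bar>h y\<bar>" by blast
    have "1 < \<bar>h x\<bar>" using x(1) c(1) by (intro gt) auto
    moreover have "min m \<bar>h x\<bar> \<le> \<bar>h y\<bar>" if "y \<in> {r<..b}" for y
      using c(2)[of y] x(2)[of y] that by (cases "y < c") auto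
    ultimately show thesis using m(1) by (intro that[of "min m \<bar>h x\<bar>"]) auto
  next
    case False
    have "m \<le> \<bar>h y\<bar>" if "y \<in> {r<..b}" for y using c(2)[of y] that False by auto
    then show thesis using that m(1) by blast
  qed
qed

lemma deriv_at_of_within:
  fixes g g' :: "real \<Rightarrow> real"
  assumes "C1_with_deriv S g g'" "x \<in> T" "open T" "T \<subseteq> S"
  shows "(g has_real_derivative g' x) (at x)"
proof -
  have "(g has_real_derivative g' x) (at x within S)" using assms by (auto simp: C1_with_deriv_def)
  then show ?thesis using at_within_open_subset[OF assms(2-4)] by simp
qed

theorem theorem1p2:
  fixes f :: "real \<Rightarrow> real"
  assumes "f ` {0..1} \<subseteq> {0..1}"
    and "\<exists>r\<^sub>1\<in>{0<..<1}. two_branched f r\<^sub>1"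
  shows "strong_winning (0, 1) (orbit_avoids_0 f)"
proof -
  obtain r where r: "0 < r" "r < 1" and "two_branched f r" using assms(2) by auto
  then obtain f' f'' l A \<gamma> where imgL: "f ` {0<..<r} = {0<..<1}" and imgR: "f ` {r<..<1} = {0<..<1}"
    and C1L: "C1_with_deriv {0..<r} f f'"
    and C1: "C1_with_deriv ({0<..<r} \<union> {r<..1}) f f'"
    and C2: "C1_with_deriv ({0<..<r} \<union> {r<..1}) f' f''"
    and f0: "f 0 = 0" and f'0: "f' 0 = 1"
    and exp_all: "\<forall>x\<in>{0<..1} - {r}. \<bar>f' x\<bar> > 1"
    and l: "(f' \<longlongrightarrow> l) (at_right r)" "\<bar>l\<bar> > 1"
    and bdd1: "bdd_above ((\<lambda>x. \<bar>f' x\<bar>) ` ({0..1} - {r}))"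
    and bdd2: "bdd_above ((\<lambda>x. \<bar>f'' x\<bar>) ` {r<..1})"
    and A_ge1: "A \<ge> 1"
    and pow: "\<forall>x\<in>{0<..<r}. inverse A \<le> f'' x / x powr (\<gamma> - 1) \<and> f'' x / x powr (\<gamma> - 1) \<le> A"
    unfolding two_branched_def by (elim exE conjE) (rule that, assumption+)
  have exp: "1 < \<bar>f' x\<bar>" if "x \<in> {0<..1} - {r}" for x using exp_all that by blast
  have derL: "(f has_real_derivative f' x) (at x)" if "x \<in> {0<..<r}" for x
    by (rule deriv_at_of_within[OF C1 that]) auto
  have derR: "(f has_real_derivative f' x) (at x)" if "x \<in> {r<..<1}" for x
    by (rule deriv_at_of_within[OF C1 that]) auto
  have der2L: "(f' has_real_derivative f'' x) (at x)" if "x \<in> {0<..<r}" for x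
    by (rule deriv_at_of_within[OF C2 that]) auto
  have der2R: "(f' has_real_derivative f'' x) (at x)" if "x \<in> {r<..<1}" for x
    by (rule deriv_at_of_within[OF C2 that]) auto
  have contR: "continuous_on {r<..1} f'"
    using C1 by (auto simp: C1_with_deriv_def intro: continuous_on_subset)
  have expR: "1 < \<bar>f' x\<bar>" if "x \<in> {r<..1}" for x using exp[of x] that r by auto
  obtain \<mu> where \<mu>: "1 < \<mu>" "\<And>x. x \<in> {r<..1} \<Longrightarrow> \<mu> \<le> \<bar>f' x\<bar>"
    by (rule uniform_expansion_of_limit[OF contR _ l], erule expR, (rule that; blast))
  have ge1: "1 \<le> f' x" if x: "x \<in> {0<..<r}" for x
  proof (rule ccontr)
    assume "\<not> 1 \<le> f' x"
    then have neg: "f' x \<le> 0" using exp[of x] x r by auto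
    have "connected (f' ` {0..<r})"
      using C1L by (intro connected_continuous_image) (auto simp: C1_with_deriv_def)
    from connectedD_interval[OF this imageI[of x] imageI[of 0] neg] x r f'0
    obtain t where "t \<in> {0..<r}" "f' t = 0" by force
    then show False using exp[of t] f'0 r by (cases "t = 0") auto
  qed
  obtain D where D: "\<And>x. x \<in> {0..1} - {r} \<Longrightarrow> \<bar>f' x\<bar> \<le> D"
    using bdd1 by (fastforce simp: bdd_above_def)
  obtain E where E: "\<And>x. x \<in> {r<..1} \<Longrightarrow> \<bar>f'' x\<bar> \<le> E"
    using bdd2 by (fastforce simp: bdd_above_def)
  have E0: "0 \<le> E" using E[of 1] r by auto
  have lipR: "\<bar>f' x - f' y\<bar> \<le> E * \<bar>x - y\<bar>" if xy: "x \<in> {r<..<1}" "y \<in> {r<..<1}" for x y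
  proof -
    have *: "\<bar>f' x - f' y\<bar> \<le> E * \<bar>x - y\<bar>" if xy: "x \<in> {r<..<1}" "y \<in> {r<..<1}" "x < y" for x y
    proof -
      obtain t where t: "x < t" "t < y" "f' y - f' x = (y - x) * f'' t"
        using MVT2[OF xy(3), of f' f''] der2R xy by auto
      have "\<bar>f'' t\<bar> \<le> E" using t xy by (intro E) auto
      then have "\<bar>y - x\<bar> * \<bar>f'' t\<bar> \<le> \<bar>y - x\<bar> * E" by (rule mult_left_mono) simp
      then show ?thesis using t(3) by (simp add: abs_minus_commute[of "f' x"] abs_minus_commute[of x] abs_mult mult.commute)
    qed
    show ?thesis using *[of x y] *[of y x] xy
      by (cases x y rule: linorder_cases) (auto simp: abs_minus_commute)
  qed
  have A: "inverse A \<le> f'' x / x powr (\<gamma> - 1)" "f'' x / x powr (\<gamma> - 1) \<le> A"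
    if "x \<in> {0<..<r}" for x using pow that by blast+
  have tendsto1: "(f \<longlongrightarrow> f 1) (at_left 1)"
  proof -
    have "(f has_real_derivative f' 1) (at 1 within {0<..<r} \<union> {r<..1})"
      using C1 r by (auto simp: C1_with_deriv_def)
    then have "(f has_real_derivative f' 1) (at 1 within {r<..<1})"
      by (rule DERIV_subset) auto
    from DERIV_continuous[OF this] have "(f \<longlongrightarrow> f 1) (at 1 within {r<..<1})"
      by (simp add: continuous_within)
    moreover have "at 1 within {r<..<1} = at_left 1"
      by (rule at_within_nhd[of 1 "{r<..}"]) (use r in auto)
    ultimately show ?thesis by simp
  qed
  obtain g\<^sub>0 where g0: "\<And>y. y \<in> {0<..<1} \<Longrightarrow> g\<^sub>0 y \<in> {0<..<r}" "\<And>y. y \<in> {0<..<1} \<Longrightarrow> f (g\<^sub>0 y) = y"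
    "g\<^sub>0 0 = 0" "g\<^sub>0 1 = r" "\<And>x. x \<in> {0<..<r} \<Longrightarrow> g\<^sub>0 (f x) = x"
    "\<And>x y. x \<in> {0..1} \<Longrightarrow> y \<in> {0..1} \<Longrightarrow> x \<le> y \<Longrightarrow> g\<^sub>0 x \<le> g\<^sub>0 y"
    "\<And>x y. x \<in> {0..1} \<Longrightarrow> y \<in> {0..1} \<Longrightarrow> x \<le> y \<Longrightarrow> 1 * (g\<^sub>0 y - g\<^sub>0 x) \<le> y - x"
    "\<And>y. y \<in> {0<..<1} \<Longrightarrow> (g\<^sub>0 has_real_derivative inverse (f' (g\<^sub>0 y))) (at y)"
    apply (rule increasing_inverse_branch[where h = f and h' = f' and \<mu> = 1, OF r(1) _ imgL])
      apply simp
     apply (erule derL)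
    apply (erule ge1)
    subgoal premises p for g by (rule that[of g]) (fact p)+
    done
  have contR': "continuous_on {r<..<1} f'" using contR by (rule continuous_on_subset) auto
  have ge1R: "1 \<le> \<bar>f' x\<bar>" if "x \<in> {r<..<1}" for x using \<mu>(1) \<mu>(2)[of x] that by auto
  obtain g\<^sub>1 where g1: "\<And>y. y \<in> {0<..<1} \<Longrightarrow> g\<^sub>1 y \<in> {r<..<1}" "\<And>y. y \<in> {0<..<1} \<Longrightarrow> f (g\<^sub>1 y) = y"
    "g\<^sub>1 0 = r \<and> g\<^sub>1 1 = 1 \<or> g\<^sub>1 0 = 1 \<and> g\<^sub>1 1 = r" "\<And>x. x \<in> {r<..<1} \<Longrightarrow> g\<^sub>1 (f x) = x"
    "\<And>x y. x \<in> {0..1} \<Longrightarrow> y \<in> {0..1} \<Longrightarrow> 1 * \<bar>g\<^sub>1 x - g\<^sub>1 y\<bar> \<le> \<bar>x - y\<bar>"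
    "\<And>y. y \<in> {0<..<1} \<Longrightarrow> (g\<^sub>1 has_real_derivative inverse (f' (g\<^sub>1 y))) (at y)"
    apply (rule inverse_branch[where h = f and h' = f' and \<mu> = 1, OF r(2) _ imgR _ contR'])
      apply simp
     apply (erule derR)
    apply (erule ge1R)
    subgoal premises p for g by (rule that[of g]) (fact p)+
    done
  interpret neutral_map f f' f'' g\<^sub>0 g\<^sub>1 r A \<gamma> D E \<mu>
  proof
    show "f x \<in> {0..1}" if "x \<in> {0..1}" for x using assms(1) that by blast
    show "f' x \<le> D" if "x \<in> {0<..<r}" for x using D[of x] that r by force
    show "\<mu> \<le> \<bar>f' x\<bar>" if "x \<in> {r<..<1}" for x using \<mu>(2)[of x] that by simp
    show "g\<^sub>0 y - g\<^sub>0 x \<le> y - x" if "x \<in> {0..1}" "y \<in> {0..1}" "x \<le> y" for x y using g0(7)[OF that] by simp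
    show "\<bar>g\<^sub>1 x - g\<^sub>1 y\<bar> \<le> \<bar>x - y\<bar>" if "x \<in> {0..1}" "y \<in> {0..1}" for x y using g1(5)[OF that] by simp
  qed (fact r f0 tendsto1 ge1 der2L A_ge1 A \<mu>(1) E0 lipR g0(1-6) g0(8) g1(1,3,4,6))+
  show ?thesis
  proof (rule strong_winning_avoiding[of diam "\<lambda>w. G w 0"])
    show "\<And>w. 0 < diam w" "\<And>w. diam w \<le> 1" by (rule diam_pos diam_le1)+
    show "x \<in> orbit_avoids_0 f"
      if "x \<in> points (0, 1)" "0 < \<epsilon>" "\<And>w. \<epsilon> * diam w \<le> \<bar>x - G w 0\<bar>" for x \<epsilon>
      using that by (intro orbit_avoids_0I) (auto simp: points_def)
  qed (rule cylinders_sparse)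
qed

end
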